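(* Let $A\subseteq B$ be a finite graded polynomial extension, with Jacobian $J$. Then: (1) up to a nonzero multiplicative scalar, $$J=\prod_{Q\in \mathrm{Spec}_1^{\mathrm{ram}}(B)} Q^{e_Q-1};$$ (2) if the extension is well-ramified, then $$(J)\cap A=\Bigl(\prod_{Q\in \mathrm{Spec}_1^{\mathrm{ram}}(B)} Q^{e_Q}\Bigr)\qquad\text{as ideals of } A,$$ i.e. the polynomial $\prod_{Q} Q^{e_Q}$ lies in $A$ and generates the ideal $(J)\cap A$ of $A$, where $(J)=JB$.
   Context: A finite graded polynomial extension $A\subseteq B$ is the following data: $B=\mathbb{C}[X_1,\dots,X_n]$ is a polynomial algebra graded by giving positive weights to the indeterminates $X_1,\dots,X_n$; $f_1,\dots,f_n\in B$ are weighted homogeneous polynomials; $A=\mathbb{C}[f_1,\dots,f_n]\subseteq B$; and $B$ is an $A$-module of finite type (so $A$ is a polynomial algebra in $f_1,\dots,f_n$). The Jacobian of the extension is $J=\det(\partial f_i/\partial X_j)_{1\le i,j\le n}\in B$. $\mathrm{Spec}_1(B)$ and $\mathrm{Spec}_1(A)$ denote the sets of height one prime ideals of $B$ and $A$, identified with the sets of irreducible polynomials up to association. For $(Q)\in\mathrm{Spec}_1(B)$, $(Q)\cap A$ is a height one prime $(P)$ of $A$ (one says $(Q)$ lies over $(P)$), and the ramification index is $e_Q:=v_Q(P)$, the multiplicity of $Q$ in the factorisation of $P$ in $B$. $(Q)$ is ramified if $e_Q>1$, and $\mathrm{Spec}_1^{\mathrm{ram}}(B)$ is the set of ramified elements of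 $\mathrm{Spec}_1(B)$ (one chooses one polynomial $Q$ for each such ideal). The extension is well-ramified if for every $\mathfrak{p}\in \mathrm{Spec}_1(A)$, the primes of $\mathrm{Spec}_1(B)$ lying over $\mathfrak{p}$ are either all ramified or all unramified. *)

theory Defs
  imports
    "HOL-Library.Poly_Mapping"
    "HOL-Library.Extended_Nat"
    "HOL-Analysis.Determinants"
    "HOL-Algebra.Generated_Rings"
    "HOL-Algebra.Algebraic_Closure_Type"
begin

text \<open>
  Complex polynomials whose indeterminates are indexed by \<open>'n\<close>: finitely supported maps from
  monomials (exponent vectors) to coefficients, with the convolution product.
\<close>

type_synonym 'n cpoly = "('n \<Rightarrow>\<^sub>0 nat) \<Rightarrow>\<^sub>0 complex"

definition const_poly :: "complex \<Rightarrow> 'n cpoly" where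
  "const_poly c = Poly_Mapping.single 0 c"

text \<open>
  The term of \<open>m\<close> vanishes when \<open>X\<^sub>i\<close> does not occur in \<open>m\<close>, so truncated subtraction of
  exponents does no harm.
\<close>

definition partial_deriv :: "'n \<Rightarrow> 'n cpoly \<Rightarrow> 'n cpoly" where
  "partial_deriv i p =
     (\<Sum>m\<in>Poly_Mapping.keys p.
        Poly_Mapping.single (m - Poly_Mapping.single i 1)
          (of_nat (Poly_Mapping.lookup m i) * Poly_Mapping.lookup p m))"

definition jacobian :: "('n::finite \<Rightarrow> 'n cpoly) \<Rightarrow> 'n cpoly" where
  "jacobian f = det (\<chi> i j. partial_deriv j (f i))"

definition weighted_degree :: "('n::finite \<Rightarrow> nat) \<Rightarrow> ('n \<Rightarrow>\<^sub>0 nat) \<Rightarrow> nat" where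
  "weighted_degree w m = (\<Sum>i\<in>UNIV. w i * Poly_Mapping.lookup m i)"

definition weighted_homogeneous :: "('n::finite \<Rightarrow> nat) \<Rightarrow> 'n cpoly \<Rightarrow> bool" where
  "weighted_homogeneous w p \<longleftrightarrow>
     (\<exists>d. \<forall>m\<in>Poly_Mapping.keys p. weighted_degree w m = d)"

abbreviation cpoly_ring :: "'n cpoly ring" where
  "cpoly_ring \<equiv> ring_of_type_algebra"

definition subalgebra_gen :: "('n \<Rightarrow> 'n cpoly) \<Rightarrow> 'n cpoly set" where
  "subalgebra_gen f = generate_ring cpoly_ring (range const_poly \<union> range f)"

text \<open>The ring structure on a subring \<open>A\<close> of the polynomial ring.\<close>

abbreviation subring_of :: "'n cpoly set \<Rightarrow> 'n cpoly ring" where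
  "subring_of A \<equiv> cpoly_ring\<lparr>carrier := A\<rparr>"

definition module_finite_over :: "'n cpoly set \<Rightarrow> bool" where
  "module_finite_over A \<longleftrightarrow>
     (\<exists>G. finite G \<and> (\<forall>b. \<exists>c. (\<forall>g\<in>G. c g \<in> A) \<and> b = (\<Sum>g\<in>G. c g * g)))"

definition finite_graded_polynomial_extension ::
    "('n::finite \<Rightarrow> nat) \<Rightarrow> ('n \<Rightarrow> 'n cpoly) \<Rightarrow> bool" where
  "finite_graded_polynomial_extension w f \<longleftrightarrow>
     (\<forall>i. w i > 0) \<and> (\<forall>i. weighted_homogeneous w (f i)) \<and>
     module_finite_over (subalgebra_gen f)"

text \<open>The height of a prime ideal: the supremum of the lengths of chains of primes ending in it.\<close>

definition height :: "('a, 'b) ring_scheme \<Rightarrow> 'a set \<Rightarrow> enat" where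
  "height R P =
     Sup {enat n | n. \<exists>C :: nat \<Rightarrow> 'a set.
       (\<forall>i\<le>n. primeideal (C i) R) \<and> (\<forall>i<n. C i \<subset> C (Suc i)) \<and> C n = P}"

definition Spec1 :: "('a, 'b) ring_scheme \<Rightarrow> 'a set set" where
  "Spec1 R = {P. primeideal P R \<and> height R P = 1}"

definition generates :: "('a, 'b) ring_scheme \<Rightarrow> 'a \<Rightarrow> 'a set \<Rightarrow> bool" where
  "generates R a I \<longleftrightarrow> a \<in> carrier R \<and> I = PIdl\<^bsub>R\<^esub> a"

text \<open>
  The multiplicity \<open>v\<^sub>Q(P)\<close>. The library constant \<open>multiplicity\<close> has the same definition, but it
  needs a \<open>factorial_semiring\<close>, which the type \<open>'n cpoly\<close> is not declared to be.
\<close>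

definition mult_of :: "'n cpoly \<Rightarrow> 'n cpoly \<Rightarrow> nat" where
  "mult_of Q P = Max {k. Q ^ k dvd P}"

text \<open>
  The ramification index \<open>e\<^sub>Q = v\<^sub>Q(P)\<close> of a height one prime \<open>(Q)\<close> of the polynomial ring, where
  \<open>(P) = (Q) \<inter> A\<close>. The generators \<open>Q\<close> and \<open>P\<close> exist because both rings are polynomial algebras,
  and are unique up to nonzero scalars, so the choice does not matter.
\<close>

definition ram_index :: "'n cpoly set \<Rightarrow> 'n cpoly set \<Rightarrow> nat" where
  "ram_index A q =
     mult_of (SOME Q. generates cpoly_ring Q q) (SOME P. generates (subring_of A) P (q \<inter> A))"

definition ramified :: "'n cpoly set \<Rightarrow> 'n cpoly set \<Rightarrow> bool" where
  "ramified A q \<longleftrightarrow> ram_index A q > 1"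

definition Spec1_ram :: "'n cpoly set \<Rightarrow> 'n cpoly set set" where
  "Spec1_ram A = {q \<in> Spec1 cpoly_ring. ramified A q}"

definition well_ramified :: "'n cpoly set \<Rightarrow> bool" where
  "well_ramified A \<longleftrightarrow>
     (\<forall>p \<in> Spec1 (subring_of A).
        (\<forall>q \<in> Spec1 cpoly_ring. q \<inter> A = p \<longrightarrow> ramified A q) \<or>
        (\<forall>q \<in> Spec1 cpoly_ring. q \<inter> A = p \<longrightarrow> \<not> ramified A q))"

end

(*
The ring A is the image of the substitution X_i -> f_i, and every b in B is integral over A. A monic
polynomial over A of minimal degree which kills X_j modulo a prime Q of B (or modulo Q = 0) has a
derivative that does not, as this derivative is a scalar multiple of a monic polynomial.
Differentiating the relation shows that the gradients of f_1, ..., f_n and Q span the full space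
generically on Q = 0.

For Q = 0 this gives J <> 0, whence the algebraic independence of the f_i. For a prime Q it gives two
things. First, Q contracts to a principal prime (P) of A, P = F(f): another relation would yield one
that is free of a variable occurring in F and then, by Cramer's rule, one of smaller degree. Secondly,
if P = Q^e R and F_i(f) is not in (Q), where F_i is the i-th partial derivative of F, then F_i(f) J is
the determinant with i-th row grad P = Q^(e-1) (e R grad Q + Q grad R) and other rows grad f_k; so Q
divides J exactly e - 1 times. Part (1) follows by unique factorisation in B, and part (2) by taking
the product of the primes P below the ramified Q.
*)
theory Submission
  imports Defs "Jordan_Normal_Form.Char_Poly"
begin

section \<open>Polynomials in several indeterminates\<close>

text \<open>Determinants take the role that dimension theory usually has here. All work is done in
  the one type \<open>'n cpoly\<close>: A is studied through its source under
  \<open>subst f\<close>, where ideals and divisibility are those of a polynomial ring, and instead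
  of B/(Q) there are congruences modulo Q between matrices with entries in B. Taking Q = 0 in the
  same congruences gives the generic statement. As the indeterminates form a type, unique
  factorisation is proved by induction over sets of variables inside it; the linear order on
  \<open>'n\<close> makes the polynomials an integral domain. Fractions are replaced by
  multiplication with factors that are free of a distinguished variable or not divisible by Q.
  Characteristic zero enters at three points: a polynomial with zero partial derivative is free of
  that variable, the derivative of a nonconstant monic polynomial can be rescaled to a monic one,
  and the integer e is not divisible by Q.\<close>

abbreviation lookup where "lookup \<equiv> Poly_Mapping.lookup"
abbreviation keys where "keys \<equiv> Poly_Mapping.keys"
abbreviation single where "single \<equiv> Poly_Mapping.single"

section \<open>Additive maps given on monomials\<close>

lemma poly_mapping_sum_singles: "p = (\<Sum>m\<in>keys p. single m (lookup p m))"
proof (rule poly_mapping_eqI)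
  fix k
  have "lookup (\<Sum>m\<in>keys p. single m (lookup p m)) k = (\<Sum>m\<in>keys p. if m = k then lookup p m else 0)"
    by (simp add: lookup_sum lookup_single when_def)
  also have "\<dots> = lookup p k"
    by (simp add: in_keys_iff)
  finally show "lookup p k = lookup (\<Sum>m\<in>keys p. single m (lookup p m)) k" by simp
qed

lemma poly_mapping_additive_induct [case_names single add]:
  assumes "\<And>m c. P (single m c)" and "\<And>p q. P p \<Longrightarrow> P q \<Longrightarrow> P (p + q)"
  shows "P (p :: 'a \<Rightarrow>\<^sub>0 'b::comm_monoid_add)"
proof -
  have "P 0" using assms(1)[of undefined 0] by simp
  have "P (\<Sum>m\<in>F. single m (lookup p m))" if "finite F" for F
    using that by (induction F) (simp_all add: \<open>P 0\<close> assms)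
  from this[of "keys p"] show ?thesis by (subst poly_mapping_sum_singles) simp
qed

text \<open>The common form of \<open>subst\<close>, \<open>partial_deriv\<close> and
  \<open>as_poly\<close>, so that additivity is proved once for all three and multiplicativity once
  for the first and the last.\<close>

definition linear_ext :: "('a \<Rightarrow> 'b \<Rightarrow> 'c) \<Rightarrow> ('a \<Rightarrow>\<^sub>0 'b::zero) \<Rightarrow> 'c::comm_monoid_add" where
  "linear_ext T p = (\<Sum>m\<in>keys p. T m (lookup p m))"

lemma linear_ext_superset:
  assumes "finite F" "keys p \<subseteq> F" "\<And>m. T m 0 = 0"
  shows "linear_ext T p = (\<Sum>m\<in>F. T m (lookup p m))"
  unfolding linear_ext_def by (rule sum.mono_neutral_left) (use assms in \<open>auto simp: in_keys_iff\<close>)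

lemma linear_ext_single:
  assumes "\<And>m. T m 0 = 0"
  shows "linear_ext T (single m c) = T m c"
  using linear_ext_superset[of "{m}" "single m c" T] assms by auto

lemma linear_ext_add:
  assumes "\<And>m. T m 0 = 0" "\<And>m a b. T m (a + b) = T m a + T m b"
  shows "linear_ext T (p + q) = linear_ext T p + linear_ext T q"
proof -
  let ?F = "keys p \<union> keys q"
  have "linear_ext T (p + q) = (\<Sum>m\<in>?F. T m (lookup (p + q) m))"
    by (rule linear_ext_superset) (use keys_add[of p q] assms in auto)
  also have "\<dots> = (\<Sum>m\<in>?F. T m (lookup p m)) + (\<Sum>m\<in>?F. T m (lookup q m))"
    by (simp add: lookup_add assms sum.distrib)
  also have "\<dots> = linear_ext T p + linear_ext T q"
    using linear_ext_superset[of ?F p T] linear_ext_superset[of ?F q T] assms by simp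
  finally show ?thesis .
qed

lemma linear_ext_mult:
  fixes T :: "'a::comm_monoid_add \<Rightarrow> 'b::comm_semiring_1 \<Rightarrow> 'c::comm_semiring_1"
  assumes 0: "\<And>m. T m 0 = 0" and add: "\<And>m a b. T m (a + b) = T m a + T m b"
    and mult: "\<And>m m' a b. T (m + m') (a * b) = T m a * T m' b"
  shows "linear_ext T (p * q) = linear_ext T p * linear_ext T q"
proof (induction p rule: poly_mapping_additive_induct)
  case (single m c)
  show ?case
    by (induction q rule: poly_mapping_additive_induct)
      (simp_all add: mult_single linear_ext_single[of T, OF 0] mult linear_ext_add[of T, OF 0 add] distrib_left)
qed (simp_all add: linear_ext_add[of T, OF 0 add] distrib_right)

definition Var :: "'n \<Rightarrow> 'n cpoly" where
  "Var i = single (single i 1) 1"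

lemma const_poly_0 [simp]: "const_poly 0 = 0"
  and const_poly_1 [simp]: "const_poly 1 = 1"
  and const_poly_add: "const_poly (a + b) = const_poly a + const_poly b"
  and const_poly_mult: "const_poly (a * b) = const_poly a * const_poly b"
  by (simp_all add: const_poly_def single_add mult_single)

lemma const_poly_eq_0_iff [simp]: "const_poly c = 0 \<longleftrightarrow> c = 0"
  unfolding const_poly_def by (metis lookup_single_eq lookup_zero single_zero)

lemma of_nat_eq_const_poly: "of_nat k = const_poly (of_nat k)"
  by (induction k) (simp_all add: const_poly_add)

lemma const_poly_dvd_1: "c \<noteq> 0 \<Longrightarrow> const_poly c dvd 1"
  by (rule dvdI[of _ _ "const_poly (inverse c)"]) (simp flip: const_poly_mult)

lemma lookup_minus_single:
  "lookup (m - single i k) j = lookup m j - (if i = j then k else 0)" for m :: "'a \<Rightarrow>\<^sub>0 nat"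
  by (simp add: lookup_minus lookup_single when_def)

lemma add_minus_single: "lookup m i \<noteq> 0 \<Longrightarrow> (m - single i 1) + single i 1 = m" for m :: "'a \<Rightarrow>\<^sub>0 nat"
  by (rule poly_mapping_eqI) (auto simp: lookup_minus_single lookup_add lookup_single when_def)

lemma cpoly_induct [case_names const Var add mult]:
  fixes p :: "'n::finite cpoly"
  assumes const: "\<And>c. P (const_poly c)" and Var: "\<And>i. P (Var i)"
    and add: "\<And>p q. P p \<Longrightarrow> P q \<Longrightarrow> P (p + q)" and mult: "\<And>p q. P p \<Longrightarrow> P q \<Longrightarrow> P (p * q)"
  shows "P p"
proof (induction p rule: poly_mapping_additive_induct)
  case (single m c)
  show ?case
  proof (induction "\<Sum>i\<in>UNIV. lookup m i" arbitrary: m rule: less_induct)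
    case less
    show ?case
    proof (cases "m = 0")
      case True
      then show ?thesis using const[of c] by (simp add: const_poly_def)
    next
      case False
      then obtain i where i: "lookup m i \<noteq> 0" by (metis lookup_zero poly_mapping_eqI)
      have "(\<Sum>j\<in>UNIV. lookup (m - single i 1) j) < (\<Sum>j\<in>UNIV. lookup m j)"
        by (rule sum_strict_mono_ex1) (use i in \<open>auto simp: lookup_minus_single\<close>)
      from less[OF this] have "P (single (m - single i 1) c * Var i)" by (rule mult[OF _ Var])
      then show ?thesis by (simp add: Var_def mult_single add_minus_single[OF i, simplified])
    qed
  qed
qed (rule add)

subsection \<open>Substitution\<close>

definition subst :: "('n::finite \<Rightarrow> 'n cpoly) \<Rightarrow> 'n cpoly \<Rightarrow> 'n cpoly" where
  "subst f = linear_ext (\<lambda>m c. const_poly c * (\<Prod>i\<in>UNIV. f i ^ lookup m i))"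

lemma subst_add: "subst f (p + q) = subst f p + subst f q"
  unfolding subst_def by (rule linear_ext_add) (simp_all add: const_poly_add distrib_right)

lemma subst_mult: "subst f (p * q) = subst f p * subst f q"
  unfolding subst_def
  by (rule linear_ext_mult)
    (simp_all add: const_poly_add distrib_right const_poly_mult lookup_add power_add prod.distrib ac_simps)

lemma subst_const [simp]: "subst f (const_poly c) = const_poly c"
  unfolding subst_def by (subst const_poly_def, subst linear_ext_single) simp_all

lemma subst_Var [simp]: "subst f (Var i) = f i"
  unfolding subst_def Var_def
  by (subst linear_ext_single) (simp_all add: lookup_single when_def if_distrib[of "\<lambda>k. _ ^ k"] cong: if_cong)

lemma subst_0 [simp]: "subst f 0 = 0"
  using subst_const[of f 0] by simp

lemma subst_1 [simp]: "subst f 1 = 1"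
  using subst_const[of f 1] by simp

interpretation subst: comm_ring_hom "subst f" for f
  by unfold_locales (simp_all add: subst_add subst_mult)

subsection \<open>Partial derivatives\<close>

lemma partial_deriv_eq: "partial_deriv i =
    linear_ext (\<lambda>m c. single (m - single i 1) (of_nat (lookup m i) * c))"
  unfolding partial_deriv_def linear_ext_def by (rule ext) simp

lemma partial_deriv_single:
  "partial_deriv i (single m c) = single (m - single i 1) (of_nat (lookup m i) * c)"
  unfolding partial_deriv_eq by (rule linear_ext_single) simp

lemma partial_deriv_add: "partial_deriv i (p + q) = partial_deriv i p + partial_deriv i q"
  unfolding partial_deriv_eq by (rule linear_ext_add) (simp_all add: distrib_left single_add)

lemma partial_deriv_mult:
  "partial_deriv i (p * q) = partial_deriv i p * q + p * partial_deriv i q"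
proof (induction p rule: poly_mapping_additive_induct)
  case (single m c)
  show ?case
  proof (induction q rule: poly_mapping_additive_induct)
    case (single m' c')
    \<comment> \<open>Truncated subtraction fails to commute with adding \<open>m'\<close> only if
      \<open>X_i\<close> is absent from \<open>m\<close>, and then both coefficients are 0. The
      claim is general in \<open>m\<close> and \<open>m'\<close> because it is applied with the two
      monomials in both orders.\<close>
    have *: "single (m - single i 1 + m') (of_nat (lookup m i) * a) = single (m + m' - single i 1) (of_nat (lookup m i) * a)"
      for m m' :: "'a \<Rightarrow>\<^sub>0 nat" and a :: complex
    proof (cases "lookup m i = 0")
      case False
      then have "m - single i 1 + m' = m + m' - single i 1"
        by (intro poly_mapping_eqI) (auto simp: lookup_minus_single[of _ i 1, simplified] lookup_add)
      then show ?thesis by simp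
    qed simp
    show ?case
      using *[of m m' "c * c'"] *[of m' m "c * c'"]
      by (simp add: mult_single partial_deriv_single lookup_add distrib_left distrib_right single_add ac_simps)
  qed (simp add: distrib_left distrib_right partial_deriv_add)
qed (simp add: distrib_left distrib_right partial_deriv_add)

lemma partial_deriv_const [simp]: "partial_deriv i (const_poly c) = 0"
  by (simp add: const_poly_def partial_deriv_single)

lemma partial_deriv_0 [simp]: "partial_deriv i 0 = 0"
  using partial_deriv_const[of i 0] by simp

lemma partial_deriv_Var: "partial_deriv i (Var j) = (if i = j then 1 else 0)"
  by (auto simp: Var_def partial_deriv_single lookup_single when_def)

lemma partial_deriv_chain:
  fixes f :: "'n::finite \<Rightarrow> 'n cpoly"
  shows "partial_deriv j (subst f p) = (\<Sum>i\<in>UNIV. subst f (partial_deriv i p) * partial_deriv j (f i))"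
proof (induction p rule: cpoly_induct)
  case (Var i)
  show ?case by (simp add: partial_deriv_Var if_distrib[of "subst f"] if_distrib[of "\<lambda>x. x * _"] cong: if_cong)
next
  case (mult p q)
  then show ?case
    by (simp add: partial_deriv_mult subst_mult subst_add distrib_left distrib_right sum.distrib sum_distrib_left sum_distrib_right ac_simps)
qed (simp_all add: partial_deriv_add subst_add distrib_right sum.distrib)

lemma partial_deriv_power:
  "partial_deriv i (p ^ Suc k) = of_nat (Suc k) * p ^ k * partial_deriv i p"
  by (induction k) (simp_all add: partial_deriv_mult algebra_simps)

lemma lookup_partial_deriv:
  "lookup (partial_deriv i p) m = of_nat (lookup m i + 1) * lookup p (m + single i 1)"
proof (induction p rule: poly_mapping_additive_induct)
  case (single m' c)
  show ?case
  proof (cases "m' = m + single i 1")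
    case True
    then have "m' - single i 1 = m" "lookup m' i = lookup m i + 1"
      by (simp_all add: lookup_add)
    with True show ?thesis by (simp add: partial_deriv_single)
  next
    case False
    then have "m' - single i 1 \<noteq> m \<or> lookup m' i = 0"
      by (metis add_minus_single)
    then show ?thesis
      using False by (elim disjE) (simp_all add: partial_deriv_single lookup_single_not_eq)
  qed
qed (simp add: partial_deriv_add lookup_add distrib_left)

subsection \<open>Polynomials as univariate polynomials in one indeterminate\<close>

text \<open>The coefficients stay in the type \<open>'n cpoly\<close> although \<open>x\<close> does
  not occur in them; hence evaluation at \<open>Var x\<close> recovers the polynomial.\<close>

definition as_poly :: "'n \<Rightarrow> 'n cpoly \<Rightarrow> 'n cpoly poly" where
  "as_poly x = linear_ext (\<lambda>m c. Polynomial.monom (single (m - single x (lookup m x)) c) (lookup m x))"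

lemma as_poly_add: "as_poly x (p + q) = as_poly x p + as_poly x q"
  unfolding as_poly_def by (rule linear_ext_add) (simp_all add: single_add add_monom)

lemma as_poly_mult: "as_poly x (p * q) = as_poly x p * as_poly x q"
proof -
  have "m + m' - single x (lookup m x + lookup m' x) = (m - single x (lookup m x)) + (m' - single x (lookup m' x))"
    for m m' :: "'a \<Rightarrow>\<^sub>0 nat"
    by (rule poly_mapping_eqI) (auto simp: lookup_minus_single lookup_add)
  note * = this
  show ?thesis
    unfolding as_poly_def
  proof (rule linear_ext_mult)
    fix m m' :: "'a \<Rightarrow>\<^sub>0 nat" and a b :: complex
    show "Polynomial.monom (single (m + m' - single x (lookup (m + m') x)) (a * b)) (lookup (m + m') x) =
      Polynomial.monom (single (m - single x (lookup m x)) a) (lookup m x) *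
      Polynomial.monom (single (m' - single x (lookup m' x)) b) (lookup m' x)"
      unfolding lookup_add * mult_monom mult_single ..
  qed (simp_all add: single_add add_monom)
qed

lemma as_poly_single: "as_poly x (single m c) =
   Polynomial.monom (single (m - single x (lookup m x)) c) (lookup m x)"
  unfolding as_poly_def by (rule linear_ext_single) simp

lemma as_poly_0 [simp]: "as_poly x 0 = 0"
  by (simp add: as_poly_def linear_ext_def)

lemma lookup_coeff_as_poly:
  "lookup (coeff (as_poly x p) k) m = (lookup p (m + single x k) when lookup m x = 0)"
proof (induction p rule: poly_mapping_additive_induct)
  case (single m' c)
  have "m' - single x (lookup m' x) = m \<longleftrightarrow> lookup m x = 0 \<and> m' = m + single x k" if "lookup m' x = k"
  proof
    assume *: "m' - single x (lookup m' x) = m"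
    from * have "lookup m x = 0" by (auto simp: lookup_minus_single)
    moreover have "m' = m + single x k"
      unfolding *[symmetric] using that
      by (intro poly_mapping_eqI) (auto simp: lookup_minus_single lookup_add lookup_single when_def)
    ultimately show "lookup m x = 0 \<and> m' = m + single x k" ..
  next
    assume *: "lookup m x = 0 \<and> m' = m + single x k"
    then show "m' - single x (lookup m' x) = m"
      by (intro poly_mapping_eqI) (auto simp: lookup_minus_single lookup_add lookup_single when_def)
  qed
  then show ?case
    by (auto simp: as_poly_single coeff_monom lookup_single when_def lookup_add)
qed (simp add: as_poly_add lookup_add when_def)

lemma Var_power: "Var i ^ k = single (single i k) 1"
  by (induction k) (simp_all add: Var_def mult_single flip: single_add)

lemma poly_as_poly: "poly (as_poly x p) (Var x) = p" for p :: "'n::linorder cpoly"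
proof (induction p rule: poly_mapping_additive_induct)
  case (single m c)
  have "m - single x (lookup m x) + single x (lookup m x) = m"
    by (rule poly_mapping_eqI) (auto simp: lookup_minus_single lookup_add lookup_single when_def)
  then show ?case
    by (simp add: as_poly_single poly_monom Var_power mult_single)
qed (simp add: as_poly_add)

definition deg :: "'n \<Rightarrow> 'n cpoly \<Rightarrow> nat" where
  "deg x p = Polynomial.degree (as_poly x p)"

lemma as_poly_eq_0_iff [simp]: "as_poly x p = 0 \<longleftrightarrow> p = 0" for p :: "'n::linorder cpoly"
  by (metis as_poly_0 poly_as_poly poly_0)

lemma deg_mult: "p \<noteq> 0 \<Longrightarrow> q \<noteq> 0 \<Longrightarrow> deg x (p * q) = deg x p + deg x q" for p q :: "'n::linorder cpoly"
  by (simp add: deg_def as_poly_mult degree_mult_eq)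

lemma deg_add_le: "deg x p \<le> n \<Longrightarrow> deg x q \<le> n \<Longrightarrow> deg x (p + q) \<le> n"
  by (simp add: deg_def as_poly_add degree_add_le)

lemma deg_le_iff: "deg x p \<le> n \<longleftrightarrow> (\<forall>m\<in>keys p. lookup m x \<le> n)"
proof
  assume *: "deg x p \<le> n"
  show "\<forall>m\<in>keys p. lookup m x \<le> n"
  proof
    fix m assume m: "m \<in> keys p"
    have "m - single x (lookup m x) + single x (lookup m x) = m"
      by (rule poly_mapping_eqI) (auto simp: lookup_minus_single lookup_add lookup_single when_def)
    then have "lookup (coeff (as_poly x p) (lookup m x)) (m - single x (lookup m x)) = lookup p m"
      by (simp add: lookup_coeff_as_poly lookup_minus_single)
    then have "coeff (as_poly x p) (lookup m x) \<noteq> 0" using m by (auto simp: in_keys_iff)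
    then have "lookup m x \<le> deg x p" unfolding deg_def by (rule le_degree)
    then show "lookup m x \<le> n" using * by (rule le_trans)
  qed
next
  assume *: "\<forall>m\<in>keys p. lookup m x \<le> n"
  show "deg x p \<le> n" unfolding deg_def
  proof (rule degree_le, intro allI impI poly_mapping_eqI)
    fix i m assume "n < i"
    then have "lookup p (m + single x i) = 0"
      using *[rule_format, of "m + single x i"] by (auto simp: in_keys_iff lookup_add)
    then show "lookup (coeff (as_poly x p) i) m = lookup 0 m" by (simp add: lookup_coeff_as_poly)
  qed
qed

lemma deg_eq_0_iff: "deg x p = 0 \<longleftrightarrow> (\<forall>m\<in>keys p. lookup m x = 0)"
  using deg_le_iff[of x p 0] by simp

lemma deg_const [simp]: "deg x (const_poly c) = 0"
  by (simp add: deg_eq_0_iff const_poly_def)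

lemma deg_0 [simp]: "deg x 0 = 0"
  by (simp add: deg_def)

lemma deg_1 [simp]: "deg x 1 = 0"
  using deg_const[of x 1] by simp

lemma deg_uminus [simp]: "deg x (- p) = deg x p"
proof -
  have "deg x (- p) \<le> n \<longleftrightarrow> deg x p \<le> n" for n
    by (simp only: deg_le_iff in_keys_iff lookup_uminus neg_equal_0_iff_equal Ball_def)
  then show ?thesis by (meson antisym order_refl)
qed

lemma deg_coeff_as_poly_le: "deg y (coeff (as_poly x p) k) \<le> deg y p"
  unfolding deg_le_iff
proof
  fix m assume "m \<in> keys (coeff (as_poly x p) k)"
  then have "m + single x k \<in> keys p" by (auto simp: in_keys_iff lookup_coeff_as_poly)
  then have "lookup (m + single x k) y \<le> deg y p" using deg_le_iff[of y p "deg y p"] by blast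
  then show "lookup m y \<le> deg y p" by (simp add: lookup_add)
qed

lemma deg_coeff_as_poly_self: "deg x (coeff (as_poly x p) k) = 0"
  by (auto simp: deg_eq_0_iff in_keys_iff lookup_coeff_as_poly)

lemma as_poly_const: "as_poly x p = [:p:]" if d: "deg x p = 0" for p :: "'n::linorder cpoly"
proof -
  obtain a where a: "as_poly x p = [:a:]" using d degree_eq_zeroE unfolding deg_def by blast
  with poly_as_poly[of x p] show ?thesis by simp
qed

lemma deg_partial_deriv_le: "deg j (partial_deriv i p) \<le> deg j p"
  unfolding deg_le_iff
proof
  fix m assume "m \<in> keys (partial_deriv i p)"
  then have "m + single i 1 \<in> keys p" by (auto simp: in_keys_iff lookup_partial_deriv)
  then have "lookup (m + single i 1) j \<le> deg j p" using deg_le_iff[of j p "deg j p"] by blast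
  then show "lookup m j \<le> deg j p" by (simp add: lookup_add)
qed

text \<open>Characteristic zero: a monomial containing \<open>X_i\<close> survives, since its
  coefficient is multiplied by a nonzero exponent.\<close>

lemma partial_deriv_eq_0_iff: "partial_deriv i p = 0 \<longleftrightarrow> deg i p = 0"
proof
  assume *: "partial_deriv i p = 0"
  show "deg i p = 0" unfolding deg_eq_0_iff
  proof
    fix m assume m: "m \<in> keys p"
    show "lookup m i = 0"
    proof (rule ccontr)
      assume "lookup m i \<noteq> 0"
      from add_minus_single[OF this] have "lookup (partial_deriv i p) (m - single i 1) =
          of_nat (lookup (m - single i 1) i + 1) * lookup p m"
        by (simp only: lookup_partial_deriv)
      moreover have "lookup p m \<noteq> 0" using m by (simp add: in_keys_iff)
      moreover have "(of_nat (lookup (m - single i 1) i + 1) :: complex) \<noteq> 0"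
        by (simp only: of_nat_eq_0_iff)
      ultimately show False using * by (simp del: of_nat_Suc of_nat_add)
    qed
  qed
next
  assume *: "deg i p = 0"
  show "partial_deriv i p = 0"
  proof (rule poly_mapping_eqI)
    fix m
    have "m + single i 1 \<notin> keys p" using * by (auto simp: deg_eq_0_iff lookup_add)
    then show "lookup (partial_deriv i p) m = lookup 0 m" by (simp add: lookup_partial_deriv in_keys_iff)
  qed
qed

lemma deg_partial_deriv_less: "deg i p \<noteq> 0 \<Longrightarrow> deg i (partial_deriv i p) < deg i p"
proof -
  assume *: "deg i p \<noteq> 0"
  have "deg i (partial_deriv i p) \<le> deg i p - 1"
    unfolding deg_le_iff
  proof
    fix m assume "m \<in> keys (partial_deriv i p)"
    then have "m + single i 1 \<in> keys p" by (auto simp: in_keys_iff lookup_partial_deriv)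
    then have "lookup (m + single i 1) i \<le> deg i p" using deg_le_iff[of i p "deg i p"] by blast
    then show "lookup m i \<le> deg i p - 1" by (simp add: lookup_add)
  qed
  with * show ?thesis by simp
qed

text \<open>The measure of all descents below: additive on products because each \<open>deg\<close>
  is, smaller on every nonzero partial derivative, and 0 only on constants.\<close>

definition sum_deg :: "'n::finite cpoly \<Rightarrow> nat" where
  "sum_deg p = (\<Sum>i\<in>UNIV. deg i p)"

lemma sum_deg_mult: "p \<noteq> 0 \<Longrightarrow> q \<noteq> 0 \<Longrightarrow> sum_deg (p * q) = sum_deg p + sum_deg q"
  for p q :: "'n::{finite,linorder} cpoly"
  by (simp add: sum_deg_def deg_mult sum.distrib)

lemma sum_deg_eq_0_iff: "sum_deg p = 0 \<longleftrightarrow> (\<exists>c. p = const_poly c)" for p :: "'n::finite cpoly"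
proof
  assume "sum_deg p = 0"
  then have "m = 0" if "m \<in> keys p" for m
    using that by (auto simp: sum_deg_def deg_eq_0_iff intro!: poly_mapping_eqI)
  then have "p = const_poly (lookup p 0)"
    unfolding const_poly_def
    by (intro poly_mapping_eqI) (auto simp: lookup_single when_def in_keys_iff)
  then show "\<exists>c. p = const_poly c" ..
qed (auto simp: sum_deg_def)

lemma sum_deg_partial_deriv_less:
  fixes p :: "'n::finite cpoly"
  assumes "partial_deriv i p \<noteq> 0"
  shows "sum_deg (partial_deriv i p) < sum_deg p"
  unfolding sum_deg_def
proof (rule sum_strict_mono_ex1)
  show "\<exists>a\<in>UNIV. deg a (partial_deriv i p) < deg a p"
  proof
    have "deg i p \<noteq> 0" using assms partial_deriv_eq_0_iff[of i p] by simp
    then show "deg i (partial_deriv i p) < deg i p" by (rule deg_partial_deriv_less)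
  qed simp
qed (simp_all add: deg_partial_deriv_le)

lemma dvd_1_iff: "p dvd 1 \<longleftrightarrow> p \<noteq> 0 \<and> sum_deg p = 0" for p :: "'n::{finite,linorder} cpoly"
proof
  assume "p dvd 1"
  then obtain q where q: "1 = p * q" ..
  then have "p \<noteq> 0" "q \<noteq> 0" by auto
  moreover have "sum_deg (p * q) = 0" unfolding q[symmetric] by (simp add: sum_deg_def)
  ultimately have "sum_deg p = 0" using sum_deg_mult[of p q] by simp
  with \<open>p \<noteq> 0\<close> show "p \<noteq> 0 \<and> sum_deg p = 0" ..
next
  assume "p \<noteq> 0 \<and> sum_deg p = 0"
  then show "p dvd 1" unfolding sum_deg_eq_0_iff using const_poly_dvd_1 by auto
qed

subsection \<open>Unique factorisation\<close>

lemma as_poly_1 [simp]: "as_poly x 1 = 1"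
  using as_poly_single[of x 0 1] by (simp add: monom_0 one_pCons)

interpretation as_poly: comm_ring_hom "as_poly x" for x
  by unfold_locales (simp_all add: as_poly_add as_poly_mult)

lemma as_poly_Var: "as_poly x (Var x) = Polynomial.monom 1 1"
  by (simp add: Var_def as_poly_single)

text \<open>Plays the role of the polynomial ring in the variables of \<open>S\<close>, for the
  induction over \<open>S\<close>. It contains the divisors of its nonzero elements
  (\<open>polys_in_dvd\<close>), so irreducibility in it agrees with irreducibility in the whole
  ring.\<close>

definition polys_in :: "'n set \<Rightarrow> 'n cpoly set" where
  "polys_in S = {p. \<forall>i. i \<notin> S \<longrightarrow> deg i p = 0}"

lemma polys_in_UNIV [simp]: "polys_in UNIV = UNIV"
  by (simp add: polys_in_def)

lemma polys_in_mono: "S \<subseteq> T \<Longrightarrow> polys_in S \<subseteq> polys_in T"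
  by (auto simp: polys_in_def)

lemma polys_in_add: "p \<in> polys_in S \<Longrightarrow> q \<in> polys_in S \<Longrightarrow> p + q \<in> polys_in S"
  unfolding polys_in_def using deg_add_le[of _ p 0 q] by auto

lemma polys_in_uminus: "p \<in> polys_in S \<Longrightarrow> - p \<in> polys_in S"
  by (simp add: polys_in_def)

lemma polys_in_mult: "p \<in> polys_in S \<Longrightarrow> q \<in> polys_in S \<Longrightarrow> p * q \<in> polys_in S"
  for p q :: "'n::linorder cpoly"
  unfolding polys_in_def by (cases "p = 0 \<or> q = 0") (auto simp: deg_mult)

lemma polys_in_1 [simp]: "1 \<in> polys_in S"
  and polys_in_0 [simp]: "0 \<in> polys_in S"
  by (simp_all add: polys_in_def)

lemma polys_in_power: "p \<in> polys_in S \<Longrightarrow> p ^ k \<in> polys_in S" for p :: "'n::linorder cpoly"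
  by (induction k) (auto intro: polys_in_mult)

lemma polys_in_Var: "i \<in> S \<Longrightarrow> Var i \<in> polys_in S"
  by (auto simp: polys_in_def Var_def deg_eq_0_iff lookup_single when_def)

lemma polys_in_dvd:
  fixes p q :: "'n::linorder cpoly"
  assumes "q \<in> polys_in S" "q \<noteq> 0" "p dvd q"
  shows "p \<in> polys_in S"
proof -
  from assms(3) obtain r where r: "q = p * r" ..
  with assms(2) have "p \<noteq> 0" "r \<noteq> 0" by auto
  with assms(1) show ?thesis by (simp add: r polys_in_def deg_mult)
qed

lemma coeff_as_poly_in:
  assumes "p \<in> polys_in (insert x S)" shows "coeff (as_poly x p) k \<in> polys_in S"
  unfolding polys_in_def
proof (intro CollectI allI impI)
  fix i assume i: "i \<notin> S"
  show "deg i (coeff (as_poly x p) k) = 0"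
  proof (cases "i = x")
    case True
    then show ?thesis by (simp add: deg_coeff_as_poly_self)
  next
    case False
    with i assms have "deg i p = 0" by (simp add: polys_in_def)
    then show ?thesis using deg_coeff_as_poly_le[of i x p k] by simp
  qed
qed

lemma dvd_iff_dvd_coeffs:
  fixes p a :: "'n::linorder cpoly"
  assumes "deg x p = 0"
  shows "p dvd a \<longleftrightarrow> (\<forall>k. p dvd coeff (as_poly x a) k)"
proof
  assume "p dvd a"
  then obtain b where "a = p * b" ..
  then have "as_poly x a = [:p:] * as_poly x b" by (simp add: as_poly_mult as_poly_const[OF assms])
  then have "coeff (as_poly x a) k = p * coeff (as_poly x b) k" for k by simp
  then show "\<forall>k. p dvd coeff (as_poly x a) k" by simp
next
  assume "\<forall>k. p dvd coeff (as_poly x a) k"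
  then have "[:p:] dvd as_poly x a" by (simp add: const_poly_dvd_iff)
  then obtain b where "as_poly x a = [:p:] * b" ..
  then have "poly (as_poly x a) (Var x) = p * poly b (Var x)" by simp
  then show "p dvd a" by (simp add: poly_as_poly)
qed

text \<open>Gauss's lemma: a prime of the coefficient ring stays prime when \<open>x\<close> is
  adjoined. If \<open>i\<close> and \<open>j\<close> are the least indices of coefficients not
  divisible by \<open>p\<close>, the coefficient of index \<open>i + j\<close> of the product is
  congruent to the product of these two.\<close>

lemma prime_on_polys_in_insert:
  fixes p a b :: "'n::linorder cpoly"
  assumes prime: "\<And>a b. a \<in> polys_in S \<Longrightarrow> b \<in> polys_in S \<Longrightarrow> p dvd a * b \<Longrightarrow> p dvd a \<or> p dvd b"
    and p: "p \<in> polys_in S" "x \<notin> S"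
    and a: "a \<in> polys_in (insert x S)" and b: "b \<in> polys_in (insert x S)" and dvd: "p dvd a * b"
  shows "p dvd a \<or> p dvd b"
proof (rule ccontr)
  assume ndvd: "\<not> (p dvd a \<or> p dvd b)"
  have d: "deg x p = 0" using p by (simp add: polys_in_def)
  note dvd_iff = dvd_iff_dvd_coeffs[OF d]
  define A where "A = as_poly x a"
  define B where "B = as_poly x b"
  from ndvd have "\<exists>i. \<not> p dvd coeff A i" "\<exists>j. \<not> p dvd coeff B j"
    unfolding A_def B_def using dvd_iff[of a] dvd_iff[of b] by blast+
  then obtain i j where i: "\<not> p dvd coeff A i" "\<And>k. k < i \<Longrightarrow> p dvd coeff A k"
    and j: "\<not> p dvd coeff B j" "\<And>k. k < j \<Longrightarrow> p dvd coeff B k"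
    using exists_least_iff[of "\<lambda>i. \<not> p dvd coeff A i"] exists_least_iff[of "\<lambda>i. \<not> p dvd coeff B i"] by auto
  have "p dvd coeff (A * B) (i + j)"
    using dvd dvd_iff[of "a * b"] unfolding A_def B_def as_poly_mult by blast
  also have "coeff (A * B) (i + j) = (\<Sum>k\<in>{..i + j}. coeff A k * coeff B (i + j - k))"
    by (simp add: coeff_mult)
  also have "\<dots> = coeff A i * coeff B j + (\<Sum>k\<in>{..i + j} - {i}. coeff A k * coeff B (i + j - k))"
    by (subst sum.remove[of _ i]) auto
  finally have *: "p dvd coeff A i * coeff B j + (\<Sum>k\<in>{..i + j} - {i}. coeff A k * coeff B (i + j - k))" .
  have "p dvd coeff A k * coeff B (i + j - k)" if "k \<in> {..i + j} - {i}" for k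
    using i(2)[of k] j(2)[of "i + j - k"] that by (cases "k < i") auto
  then have "p dvd (\<Sum>k\<in>{..i + j} - {i}. coeff A k * coeff B (i + j - k))"
    by (rule dvd_sum)
  with * have "p dvd coeff A i * coeff B j" using dvd_add_left_iff by blast
  with prime[of "coeff A i" "coeff B j"] i(1) j(1) show False
    using coeff_as_poly_in[OF a] coeff_as_poly_in[OF b] unfolding A_def B_def by blast
qed

lemma ex_irreducible_factor:
  fixes p :: "'n::{finite,linorder} cpoly"
  assumes "p \<noteq> 0" "\<not> p dvd 1"
  obtains r q where "irreducible r" "p = r * q" "sum_deg q < sum_deg p"
  using assms
proof (induction "sum_deg p" arbitrary: p thesis rule: less_induct)
  case less
  show ?case
  proof (cases "irreducible p")
    case True
    have "sum_deg (1 :: 'n cpoly) = 0" by (simp add: sum_deg_def)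
    moreover have "sum_deg p \<noteq> 0" using less.prems(2,3) dvd_1_iff[of p] by simp
    ultimately show thesis using less.prems(1)[of p 1] True by simp
  next
    case False
    with less.prems(2,3) obtain a b where ab: "p = a * b" "\<not> a dvd 1" "\<not> b dvd 1"
      unfolding irreducible_def by auto
    with less.prems(2) have nz: "a \<noteq> 0" "b \<noteq> 0" by auto
    with ab have "sum_deg a \<noteq> 0" "sum_deg b \<noteq> 0" using dvd_1_iff[of a] dvd_1_iff[of b] by simp_all
    with sum_deg_mult[OF nz] ab have "sum_deg a < sum_deg p" by simp
    then obtain r q where rq: "irreducible r" "a = r * q" "sum_deg q < sum_deg a"
      using less.hyps[of a] nz ab by blast
    then have "q \<noteq> 0" using nz by auto
    show thesis
    proof (rule less.prems(1)[OF rq(1)])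
      show "p = r * (q * b)" using ab rq by (simp add: ac_simps)
      show "sum_deg (q * b) < sum_deg p"
        using sum_deg_mult[OF \<open>q \<noteq> 0\<close> nz(2)] sum_deg_mult[OF nz] ab rq by simp
    qed
  qed
qed

text \<open>The irreducible factors \<open>r\<close> of \<open>d\<close> are cancelled one at a time
  from \<open>d * g = p * h\<close>. Each is prime and divides \<open>h\<close>: if it divided
  \<open>p\<close>, then \<open>p\<close> would be an associate of \<open>r\<close> and so lie in
  \<open>polys_in S\<close>.\<close>

lemma clear_factor:
  fixes p d g :: "'n::{finite,linorder} cpoly"
  assumes prime: "\<And>r a b. irreducible r \<Longrightarrow> r \<in> polys_in S \<Longrightarrow> a \<in> polys_in T \<Longrightarrow> b \<in> polys_in T \<Longrightarrow>
      r dvd a * b \<Longrightarrow> r dvd a \<or> r dvd b"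
    and ST: "S \<subseteq> T"
    and p: "irreducible p" "p \<in> polys_in T" "p \<notin> polys_in S"
    and d: "d \<in> polys_in S" "d \<noteq> 0" and g: "g \<in> polys_in T" and dvd: "p dvd d * g"
  shows "p dvd g"
  using d dvd
proof (induction "sum_deg d" arbitrary: d rule: less_induct)
  case less
  show ?case
  proof (cases "d dvd 1 \<or> g = 0")
    case True
    then show ?thesis using less.prems by (auto dest: dvd_mult_unit_iff' simp: mult.commute)
  next
    case False
    with less.prems obtain r e where re: "irreducible r" "d = r * e" "sum_deg e < sum_deg d"
      using ex_irreducible_factor by blast
    then have nz: "r \<noteq> 0" "e \<noteq> 0" using less.prems by auto
    have r: "r \<in> polys_in S" and e: "e \<in> polys_in S"
      using polys_in_dvd[OF less.prems(1,2)] re by auto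
    from less.prems(3) obtain h where h: "d * g = p * h" ..
    have "d * g \<in> polys_in T" "d * g \<noteq> 0"
      using less.prems False polys_in_mult[OF subsetD[OF polys_in_mono[OF ST]] g] by auto
    then have "h \<in> polys_in T" using polys_in_dvd h by fastforce
    have "r dvd p * h" using h re by (metis dvd_mult2 dvd_triv_left)
    then have "r dvd p \<or> r dvd h" using prime re r p \<open>h \<in> polys_in T\<close> by blast
    then have "r dvd h"
    proof
      assume "r dvd p"
      then obtain s where s: "p = r * s" ..
      then have "s dvd 1" using p(1) re(1) unfolding irreducible_def by blast
      then have "p dvd r" unfolding s by (metis dvd_refl mult.right_neutral mult_dvd_mono)
      then have "p \<in> polys_in S" using polys_in_dvd[OF r nz(1)] by blast
      with p(3) show ?thesis ..
    qed
    then obtain k where "h = r * k" ..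
    with h re nz have "e * g = p * k" by (simp add: ac_simps)
    then show ?thesis using less.hyps[OF re(3) e nz(2)] by simp
  qed
qed

text \<open>Each irreducible factor of \<open>c\<close> is prime, hence divides \<open>q\<close> or
  \<open>g\<close> and is cancelled there; \<open>e\<close> collects those taken out of
  \<open>g\<close>.\<close>

lemma split_clear_factor:
  fixes p c q g :: "'n::{finite,linorder} cpoly"
  assumes prime: "\<And>r a b. irreducible r \<Longrightarrow> r \<in> polys_in S \<Longrightarrow> a \<in> polys_in T \<Longrightarrow> b \<in> polys_in T \<Longrightarrow>
      r dvd a * b \<Longrightarrow> r dvd a \<or> r dvd b"
    and c: "c \<in> polys_in S" "c \<noteq> 0" and qg: "q \<in> polys_in T" "g \<in> polys_in T" "q \<noteq> 0" "g \<noteq> 0"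
    and eq: "c * p = q * g"
  shows "\<exists>q' g' e. p = q' * g' \<and> g = e * g' \<and> e \<in> polys_in S"
  using c qg eq
proof (induction "sum_deg c" arbitrary: c q g rule: less_induct)
  case less
  show ?case
  proof (cases "c dvd 1")
    case True
    then obtain c' where c': "1 = c * c'" ..
    have "p = (c * c') * p" by (simp flip: c')
    also have "\<dots> = c' * q * g" using less.prems(7) by (simp add: ac_simps)
    finally have "p = (c' * q) * g" .
    then show ?thesis by (intro exI[of _ "c' * q"] exI[of _ g] exI[of _ 1]) simp
  next
    case False
    with less.prems obtain r e where re: "irreducible r" "c = r * e" "sum_deg e < sum_deg c"
      using ex_irreducible_factor by blast
    then have nz: "r \<noteq> 0" "e \<noteq> 0" using less.prems by auto
    have r: "r \<in> polys_in S" and e: "e \<in> polys_in S"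
      using polys_in_dvd[OF less.prems(1,2)] re by auto
    have "r dvd q * g" unfolding less.prems(7)[symmetric] re by simp
    then consider "r dvd q" | "r dvd g" using prime re r less.prems by blast
    then show ?thesis
    proof cases
      case 1
      then obtain q2 where q2: "q = r * q2" ..
      with less.prems have "q2 \<in> polys_in T" "q2 \<noteq> 0" using polys_in_dvd[of q T q2] by auto
      moreover have "e * p = q2 * g" using less.prems(7) nz unfolding re q2 by (simp add: ac_simps)
      ultimately show ?thesis using less.hyps[OF re(3) e nz(2)] less.prems by blast
    next
      case 2
      then obtain g2 where g2: "g = r * g2" ..
      with less.prems have g2': "g2 \<in> polys_in T" "g2 \<noteq> 0" using polys_in_dvd[of g T g2] by auto
      have "e * p = q * g2" using less.prems(7) nz unfolding re g2 by (simp add: ac_simps)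
      then obtain q' g' e' where *: "p = q' * g'" "g2 = e' * g'" "e' \<in> polys_in S"
        using less.hyps[OF re(3) e nz(2) _ g2'(1) _ g2'(2)] less.prems by blast
      then show ?thesis unfolding g2
        by (intro exI[of _ q'] exI[of _ g'] exI[of _ "r * e'"]) (simp add: polys_in_mult r ac_simps)
    qed
  qed
qed

text \<open>
  An element of minimal \<open>x\<close>-degree in the ideal \<open>(p, a)\<close> divides \<open>p\<close> and \<open>a\<close> up to factors free of
  \<open>x\<close>; as \<open>p\<close> is irreducible and does not divide \<open>a\<close>, it is itself free of \<open>x\<close>.
\<close>

lemma pseudo_bezout:
  fixes p a :: "'n::{finite,linorder} cpoly"
  assumes prime: "\<And>r a b. irreducible r \<Longrightarrow> r \<in> polys_in S \<Longrightarrow> a \<in> polys_in (insert x S) \<Longrightarrow>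
      b \<in> polys_in (insert x S) \<Longrightarrow> r dvd a * b \<Longrightarrow> r dvd a \<or> r dvd b"
    and x: "x \<notin> S"
    and p: "irreducible p" "p \<in> polys_in (insert x S)" "p \<notin> polys_in S"
    and a: "a \<in> polys_in (insert x S)" and ndvd: "\<not> p dvd a"
  shows "\<exists>g u v. g \<noteq> 0 \<and> g \<in> polys_in S \<and> g = u * p + v * a"
proof -
  define T where "T = insert x S"
  define I where "I = {u * p + v * a |u v. u \<in> polys_in T \<and> v \<in> polys_in T}"
  have I_T: "k \<in> polys_in T" if "k \<in> I" for k
    using that p a by (auto simp: I_def T_def intro!: polys_in_add polys_in_mult)
  have ST: "polys_in S \<subseteq> polys_in T" unfolding T_def by (rule polys_in_mono) auto
  have "p = 1 * p + 0 * a" "a = 0 * p + 1 * a" by simp_all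
  then have pI: "p \<in> I" and aI: "a \<in> I" unfolding I_def using polys_in_1 polys_in_0 by blast+
  have I_lin: "s * k + t * l \<in> I" if "k \<in> I" "l \<in> I" "s \<in> polys_in T" "t \<in> polys_in T" for s t k l
  proof -
    from that obtain u v u' v' where *: "k = u * p + v * a" "l = u' * p + v' * a"
      "u \<in> polys_in T" "v \<in> polys_in T" "u' \<in> polys_in T" "v' \<in> polys_in T" by (auto simp: I_def)
    have "s * k + t * l = (s * u + t * u') * p + (s * v + t * v') * a"
      unfolding * by (simp add: algebra_simps)
    moreover have "s * u + t * u' \<in> polys_in T" "s * v + t * v' \<in> polys_in T"
      using * that by (auto intro!: polys_in_add polys_in_mult)
    ultimately show ?thesis unfolding I_def by blast
  qed
  have p0: "p \<noteq> 0" using p(1) by auto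
  obtain g where g: "g \<in> I" "g \<noteq> 0" and min: "\<And>k. k \<in> I \<Longrightarrow> k \<noteq> 0 \<Longrightarrow> deg x g \<le> deg x k"
    using ex_has_least_nat[of "\<lambda>k. k \<in> I \<and> k \<noteq> 0" p "deg x"] pI p0 by blast
  define G where "G = as_poly x g"
  define l where "l = coeff G (deg x g)"
  have l0: "l \<noteq> 0" unfolding l_def G_def deg_def using g by simp
  have lS: "l \<in> polys_in S" unfolding l_def G_def by (rule coeff_as_poly_in[OF I_T[OF g(1), unfolded T_def]])
  have pseudo: "\<exists>c. c \<in> polys_in S \<and> c \<noteq> 0 \<and> g dvd c * k" if "k \<in> I" for k
    using that
  proof (induction "deg x k" arbitrary: k rule: less_induct)
    case less
    show ?case
    proof (cases "k = 0")
      case True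
      then show ?thesis by (intro exI[of _ 1]) simp
    next
      case False
      define m where "m = coeff (as_poly x k) (deg x k)"
      define n where "n = deg x k - deg x g"
      have le: "deg x g \<le> deg x k" using min less.prems False by blast
      have mS: "m \<in> polys_in S" unfolding m_def by (rule coeff_as_poly_in[OF I_T[OF less.prems, unfolded T_def]])
      \<comment> \<open>Pseudo-division: scaling \<open>k\<close> by the leading coefficient
        \<open>l\<close> of \<open>g\<close> allows its top term to be cancelled inside
        \<open>I\<close> without fractions. The scaling factors accumulate in the multiplier, which
        stays free of \<open>x\<close>.\<close>
      define k' where "k' = l * k + (- (m * Var x ^ n)) * g"
      have k'I: "k' \<in> I" unfolding k'_def
        using lS mS ST by (intro I_lin less.prems g polys_in_uminus polys_in_mult polys_in_power polys_in_Var) (auto simp: T_def)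
      have dl: "deg x l = 0" and dm: "deg x m = 0" using lS mS x by (auto simp: polys_in_def)
      have K': "as_poly x k' = Polynomial.smult l (as_poly x k) - Polynomial.smult m (Polynomial.monom 1 n * G)"
        unfolding k'_def G_def
        by (simp add: as_poly_add as_poly_mult as_poly.hom_minus as_poly.hom_uminus as_poly.hom_power as_poly_const[OF dl] as_poly_const[OF dm] as_poly_Var monom_power)
      have "Polynomial.degree (as_poly x k') \<le> deg x k"
        unfolding K' using le
        by (intro degree_diff_le degree_smult_le[THEN le_trans] degree_mult_le[THEN le_trans])
          (auto simp: deg_def G_def n_def intro!: degree_smult_le[THEN le_trans] degree_mult_le[THEN le_trans] simp: degree_monom_eq)
      moreover have "coeff (as_poly x k') (deg x k) = 0"
        unfolding K' using le by (simp add: coeff_monom_mult n_def l_def m_def)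
      ultimately have "k' = 0 \<or> deg x k' < deg x k"
        unfolding deg_def by (metis as_poly_eq_0_iff eq_zero_or_degree_less)
      then obtain c where c: "c \<in> polys_in S" "c \<noteq> 0" "g dvd c * k'"
        using less.hyps[of k'] k'I by (metis dvd_0_right mult_zero_right polys_in_1 zero_neq_one)
      have "c * k' = (c * l) * k - (c * m * Var x ^ n) * g" unfolding k'_def by (simp add: algebra_simps)
      then have "g dvd (c * l) * k" using c(3) by (metis dvd_diff_left_iff dvd_triv_right)
      moreover have "c * l \<in> polys_in S" "c * l \<noteq> 0" using c lS l0 by (auto intro: polys_in_mult)
      ultimately show ?thesis by blast
    qed
  qed
  obtain c where c: "c \<in> polys_in S" "c \<noteq> 0" "g dvd c * p" using pseudo[OF pI] by blast
  obtain d where d: "d \<in> polys_in S" "d \<noteq> 0" "g dvd d * a" using pseudo[OF aI] by blast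
  from c obtain q where q: "c * p = q * g" by (metis dvd_def mult.commute)
  have cp: "c * p \<in> polys_in T" "c * p \<noteq> 0"
    using c p p0 ST by (auto simp: T_def intro!: polys_in_mult)
  then have "q \<in> polys_in T" "q \<noteq> 0" using polys_in_dvd[OF cp, of q] q by auto
  then obtain q' g' e where *: "p = q' * g'" "g = e * g'" "e \<in> polys_in S"
    using split_clear_factor[OF prime[folded T_def] c(1,2) _ I_T[OF g(1)] _ g(2) q] by blast
  \<comment> \<open>Otherwise \<open>p\<close> is an associate of \<open>g'\<close>, hence divides
    \<open>g\<close> and so \<open>d * a\<close>; clearing \<open>d\<close> contradicts
    \<open>ndvd\<close>.\<close>
  have "g' dvd 1"
  proof (rule ccontr)
    assume "\<not> g' dvd 1"
    then have "q' dvd 1" using p(1) *(1) unfolding irreducible_def by blast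
    then have "p dvd g'" unfolding *(1) by simp
    then have "p dvd d * a" using *(2) d(3) by (meson dvd_trans dvd_triv_right)
    then have "p dvd a"
      using clear_factor[OF prime _ p d(1,2) a] by blast
    with ndvd show False ..
  qed
  then have "g dvd e" unfolding *(2) by simp
  moreover have "e \<noteq> 0" using *(2) g(2) by auto
  ultimately have "g \<in> polys_in S" using *(3) polys_in_dvd by blast
  moreover obtain u v where "g = u * p + v * a" using g(1) by (auto simp: I_def)
  ultimately show ?thesis using g(2) by blast
qed

text \<open>If \<open>p\<close> is free of the new variable \<open>x\<close>, this is Gauss's lemma.
  Otherwise a combination \<open>g\<close> of \<open>p\<close> and \<open>b\<close> is free of
  \<open>x\<close>; then \<open>p\<close> divides \<open>g * a\<close>, and \<open>g\<close> can be
  cleared.\<close>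

lemma irreducible_prime_on:
  fixes p a b :: "'n::{finite,linorder} cpoly"
  assumes "finite S" "irreducible p" "p \<in> polys_in S" "a \<in> polys_in S" "b \<in> polys_in S" "p dvd a * b"
  shows "p dvd a \<or> p dvd b"
  using assms
proof (induction S arbitrary: p a b rule: finite_induct)
  case empty
  then have "sum_deg p = 0" by (simp add: polys_in_def sum_deg_def)
  with empty(1) have "p dvd 1" using dvd_1_iff[of p] by auto
  then show ?case by (meson dvd_trans one_dvd)
next
  case (insert x S)
  have prime: "r dvd a \<or> r dvd b" if "irreducible r" "r \<in> polys_in S" "a \<in> polys_in (insert x S)"
    "b \<in> polys_in (insert x S)" "r dvd a * b" for r a b
    using prime_on_polys_in_insert[OF insert.IH[OF that(1,2)] that(2) insert.hyps(2) that(3-5)] by blast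
  show ?case
  proof (cases "p \<in> polys_in S")
    case True
    then show ?thesis using prime insert.prems by blast
  next
    case False
    show ?thesis
    proof (rule disjCI)
      assume "\<not> p dvd b"
      then obtain g u v where g: "g \<noteq> 0" "g \<in> polys_in S" "g = u * p + v * b"
        using pseudo_bezout[OF prime insert.hyps(2) insert.prems(1,2) False insert.prems(4)] by blast
      have "g * a = (u * a) * p + v * (a * b)" unfolding g(3) by (simp add: algebra_simps)
      then have "p dvd g * a" using insert.prems(5) by simp
      then show "p dvd a"
        using clear_factor[OF prime _ insert.prems(1,2) False g(2,1) insert.prems(3)] by blast
    qed
  qed
qed

lemma irreducible_imp_prime_elem: "irreducible p \<Longrightarrow> prime_elem p" for p :: "'n::{finite,linorder} cpoly"
  using irreducible_prime_on[of UNIV p] by (intro prime_elemI) (auto simp: irreducible_def)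

text \<open>Elimination of \<open>x\<close>: two relations without common factor have a nonzero
  consequence in the remaining variables.\<close>

lemma bezout_in_Var:
  fixes p a :: "'n::{finite,linorder} cpoly"
  assumes "prime_elem p" "deg x p \<noteq> 0" "\<not> p dvd a"
  obtains g u v where "g \<noteq> 0" "deg x g = 0" "g = u * p + v * a"
proof -
  have ins: "insert x (UNIV - {x}) = UNIV" by auto
  have "\<exists>g u v. g \<noteq> 0 \<and> g \<in> polys_in (UNIV - {x}) \<and> g = u * p + v * a"
    by (rule pseudo_bezout)
      (use assms prime_elem_imp_irreducible[OF assms(1)] irreducible_imp_prime_elem prime_elem_dvd_mult_iff
        in \<open>auto simp: ins polys_in_def\<close>)
  then show thesis using that by (auto simp: polys_in_def)
qed

lemma ex_prime_factor:
  fixes p :: "'n::{finite,linorder} cpoly"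
  assumes "p \<noteq> 0" "\<not> p dvd 1"
  obtains r q where "prime_elem r" "p = r * q" "sum_deg q < sum_deg p"
  using ex_irreducible_factor[OF assms] irreducible_imp_prime_elem by metis

section \<open>Multiplicities and factorisation into prime powers\<close>

lemma prime_elem_dvd_prime_elem:
  fixes p q :: "'a::idom"
  assumes "prime_elem p" "prime_elem q" "p dvd q"
  shows "q dvd p"
proof -
  from assms(3) obtain r where r: "q = p * r" ..
  with assms(2) have "q dvd p \<or> q dvd r" by (metis dvd_refl prime_elem_dvd_multD)
  moreover have "\<not> q dvd r"
  proof
    assume "q dvd r"
    then obtain s where "r = q * s" ..
    with r have "q * (p * s) = q * 1" by (simp add: ac_simps)
    then have "p * s = 1" using assms(2) by (subst (asm) mult_left_cancel) auto
    then have "p dvd 1" by (metis dvd_triv_left)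
    with assms(1) show False by (simp add: prime_elem_def)
  qed
  ultimately show ?thesis by blast
qed

lemma prime_elem_power_dvd_mult_cancel:
  fixes p a b :: "'a::idom"
  assumes p: "prime_elem p" and "\<not> p dvd a" "p ^ k dvd a * b"
  shows "p ^ k dvd b"
  using assms(3)
proof (induction k arbitrary: b)
  case (Suc k)
  then have "p dvd a * b" by (metis dvd_mult_left power_Suc)
  with p assms(2) have "p dvd b" using prime_elem_dvd_multD by blast
  then obtain c where c: "b = p * c" ..
  with Suc.prems have "p * p ^ k dvd p * (a * c)" by (simp add: ac_simps)
  moreover have "p \<noteq> 0" using p by auto
  ultimately have "p ^ k dvd a * c" by simp
  then have "p ^ k dvd c" by (rule Suc.IH)
  then show ?case by (simp add: c mult_dvd_mono)
qed simp

lemma ex_power_decomposition: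
  fixes p a :: "'n::{finite,linorder} cpoly"
  assumes "a \<noteq> 0" "\<not> p dvd 1"
  obtains k b where "a = p ^ k * b" "\<not> p dvd b"
  using assms(1)
proof (induction "sum_deg a" arbitrary: a thesis rule: less_induct)
  case less
  show ?case
  proof (cases "p dvd a")
    case True
    then obtain c where c: "a = p * c" ..
    with less.prems(2) have nz: "p \<noteq> 0" "c \<noteq> 0" by auto
    with assms(2) have "sum_deg p \<noteq> 0" using dvd_1_iff[of p] by simp
    with sum_deg_mult[OF nz] c have "sum_deg c < sum_deg a" by simp
    from less.hyps[OF this _ nz(2)] obtain k b where "c = p ^ k * b" "\<not> p dvd b" by blast
    then show thesis using less.prems(1)[of "Suc k" b] c by (simp add: ac_simps)
  next
    case False
    then show thesis using less.prems(1)[of 0 a] by simp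
  qed
qed

text \<open>Principal ideals represent classes of associates, so products over primes up to
  association become products over sets of ideals, with any choice of generators.\<close>

definition multiples :: "'a::comm_semiring_1 \<Rightarrow> 'a set" where
  "multiples p = {a. p dvd a}"

lemma mem_multiples [simp]: "a \<in> multiples p \<longleftrightarrow> p dvd a"
  by (simp add: multiples_def)

lemma multiples_eq_iff: "multiples p = multiples q \<longleftrightarrow> p dvd q \<and> q dvd p"
proof
  assume *: "multiples p = multiples q"
  have "p \<in> multiples p" "q \<in> multiples q" by simp_all
  then have "p \<in> multiples q" "q \<in> multiples p" by (simp_all only: *)
  then show "p dvd q \<and> q dvd p" by simp
next
  assume *: "p dvd q \<and> q dvd p"
  show "multiples p = multiples q"
    by (rule Set.set_eqI) (use * dvd_trans[of p q] dvd_trans[of q p] in auto)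
qed

lemma multiples_eq_if_prime_dvd:
  "prime_elem p \<Longrightarrow> prime_elem q \<Longrightarrow> p dvd q \<Longrightarrow> multiples p = multiples q" for p q :: "'a::idom"
  using prime_elem_dvd_prime_elem multiples_eq_iff by blast

lemma prime_elem_if_multiples_eq:
  fixes p q :: "'a::idom"
  assumes "prime_elem p" "multiples q = multiples p"
  shows "prime_elem q"
proof -
  have qp: "q dvd p" "p dvd q" using assms(2) multiples_eq_iff by blast+
  have iff: "q dvd a \<longleftrightarrow> p dvd a" for a using qp dvd_trans by blast
  have "q \<noteq> 0" using qp(1) assms(1) by auto
  then show ?thesis
    using assms(1) unfolding prime_elem_def iff by blast
qed

definition prime_divisors :: "'a::comm_semiring_1 \<Rightarrow> 'a set set" where
  "prime_divisors a = {multiples p |p. prime_elem p \<and> p dvd a}"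

lemma finite_prime_divisors:
  fixes a :: "'n::{finite,linorder} cpoly"
  assumes "a \<noteq> 0"
  shows "finite (prime_divisors a)"
  using assms
proof (induction "sum_deg a" arbitrary: a rule: less_induct)
  case less
  show ?case
  proof (cases "a dvd 1")
    case True
    then have "prime_divisors a = {}"
      unfolding prime_divisors_def prime_elem_def using dvd_trans by blast
    then show ?thesis by simp
  next
    case False
    with less.prems obtain r q where r: "prime_elem r" "a = r * q" "sum_deg q < sum_deg a"
      using ex_prime_factor by blast
    have "prime_divisors a \<subseteq> insert (multiples r) (prime_divisors q)"
    proof
      fix x assume "x \<in> prime_divisors a"
      then obtain p where p: "x = multiples p" "prime_elem p" "p dvd a" by (auto simp: prime_divisors_def)
      then have "p dvd r \<or> p dvd q" unfolding r(2) using prime_elem_dvd_multD by blast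
      then show "x \<in> insert (multiples r) (prime_divisors q)"
        using p r(1) multiples_eq_if_prime_dvd[of p r] by (auto simp: prime_divisors_def)
    qed
    moreover have "finite (prime_divisors q)" using less.hyps[OF r(3)] less.prems r(2) by auto
    ultimately show ?thesis using finite_subset by blast
  qed
qed

lemma prime_elem_not_dvd_prod:
  fixes p :: "'a::idom"
  assumes "prime_elem p" "finite S" "\<And>x. x \<in> S \<Longrightarrow> \<not> p dvd g x"
  shows "\<not> p dvd (\<Prod>x\<in>S. g x)"
  using assms(2,3)
proof (induction S rule: finite_induct)
  case (insert x S)
  then show ?case by (auto simp: prime_elem_dvd_mult_iff[OF assms(1)])
qed (use assms(1) in \<open>simp add: prime_elem_def\<close>)

lemma prod_prime_powers_dvd:
  fixes a :: "'a::idom"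
  assumes "finite S" "\<And>x. x \<in> S \<Longrightarrow> prime_elem (g x)" "inj_on (\<lambda>x. multiples (g x)) S"
    and "\<And>x. x \<in> S \<Longrightarrow> g x ^ k x dvd a"
  shows "(\<Prod>x\<in>S. g x ^ k x) dvd a"
  using assms
proof (induction S rule: finite_induct)
  case (insert x S)
  then have "(\<Prod>x\<in>S. g x ^ k x) dvd a" by simp
  then obtain b where b: "a = (\<Prod>x\<in>S. g x ^ k x) * b" ..
  have "\<not> g x dvd g y" if "y \<in> S" for y
    using insert.prems(1,2) insert.hyps that multiples_eq_if_prime_dvd[of "g x" "g y"] by (auto simp: inj_on_def)
  then have "\<not> g x dvd (\<Prod>x\<in>S. g x ^ k x)"
    using insert by (intro prime_elem_not_dvd_prod) (auto dest: prime_elem_dvd_power)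
  moreover have "g x ^ k x dvd (\<Prod>x\<in>S. g x ^ k x) * b"
    using insert.prems(3)[of x] unfolding b[symmetric] by simp
  moreover have "prime_elem (g x)" using insert.prems(1) by simp
  ultimately have "g x ^ k x dvd b" using prime_elem_power_dvd_mult_cancel by blast
  then have "(\<Prod>x\<in>S. g x ^ k x) * g x ^ k x dvd a"
    unfolding b by (intro mult_dvd_mono dvd_refl)
  then show ?case using insert.hyps by (simp add: mult.commute)
qed simp

text \<open>A prime factor of the cofactor would raise the multiplicity of its class in
  \<open>a\<close>, so the cofactor is a unit, that is, a nonzero constant. Exponents are given by
  exact divisibility, as this serves both for J with \<open>e - 1\<close> and for an element of A
  with \<open>e\<close>.\<close>

lemma prime_power_factorisation:
  fixes a :: "'n::{finite,linorder} cpoly"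
  assumes a: "a \<noteq> 0" and g: "\<And>x. x \<in> prime_divisors a \<Longrightarrow> multiples (g x) = x"
    and k: "\<And>x. x \<in> prime_divisors a \<Longrightarrow> g x ^ k x dvd a \<and> \<not> g x ^ Suc (k x) dvd a"
  shows "\<exists>c. c \<noteq> 0 \<and> a = const_poly c * (\<Prod>x\<in>prime_divisors a. g x ^ k x)"
proof -
  let ?P = "\<Prod>x\<in>prime_divisors a. g x ^ k x"
  have prime: "prime_elem (g x)" if "x \<in> prime_divisors a" for x
    using that g[OF that] prime_elem_if_multiples_eq by (auto simp: prime_divisors_def)
  have "?P dvd a"
    using prime k g by (intro prod_prime_powers_dvd finite_prime_divisors a) (auto intro: inj_onI)
  then obtain b where b: "a = ?P * b" ..
  have "b dvd 1"
  proof (rule ccontr)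
    assume nb: "\<not> b dvd 1"
    have "b \<noteq> 0"
    proof
      assume "b = 0"
      with b have "a = 0" by simp
      with a show False ..
    qed
    then obtain r q where r: "prime_elem r" "b = r * q" using ex_prime_factor[OF _ nb] by blast
    then have "r dvd a" by (subst b) simp
    with r(1) have x: "multiples r \<in> prime_divisors a" (is "?x \<in> _")
      unfolding prime_divisors_def by blast
    then have "g ?x dvd r" using g[OF x] multiples_eq_iff by blast
    then have 1: "g ?x dvd b" using r(2) by simp
    have 2: "g ?x ^ k ?x dvd ?P" using finite_prime_divisors[OF a] x by (rule dvd_prodI)
    have "g ?x ^ k ?x * g ?x dvd a" by (subst b) (rule mult_dvd_mono[OF 2 1])
    then have "g ?x ^ Suc (k ?x) dvd a" by (simp only: power_Suc2)
    with k[OF x] show False by blast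
  qed
  then obtain c where c: "b = const_poly c" "b \<noteq> 0" unfolding dvd_1_iff sum_deg_eq_0_iff by blast
  have "a = const_poly c * ?P" by (rule trans[OF b[unfolded c(1)] mult.commute])
  with c show ?thesis by (intro exI[of _ c]) auto
qed

section \<open>Integrality\<close>

text \<open>
  Multiplication by \<open>b\<close> on the generators of the module has a matrix over the subring, and \<open>b\<close> is
  a root of its characteristic polynomial.
\<close>

lemma integral_over_image:
  fixes h :: "'a::comm_ring_1 \<Rightarrow> 'b::comm_ring_1" and b :: 'b
  assumes hom: "comm_ring_hom h" and fin: "finite G"
    and gen: "\<And>b. \<exists>c. b = (\<Sum>g\<in>G. h (c g) * g)"
  obtains p where "lead_coeff p = 1" "poly (map_poly h p) b = 0"
proof -
  interpret comm_ring_hom h by (rule hom)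
  have ev: "comm_ring_hom (\<lambda>p. poly p b)" by unfold_locales simp_all
  obtain gs where gs: "set gs = G" "distinct gs" using finite_distinct_list[OF fin] by blast
  define n where "n = length gs"
  have sum_gs: "(\<Sum>g\<in>G. F g) = (\<Sum>j<n. F (gs ! j))" for F :: "'b \<Rightarrow> 'b"
    by (rule sum.reindex_bij_betw[symmetric], rule bij_betw_nth) (simp_all add: gs n_def)
  have "\<forall>i. \<exists>c. b * gs ! i = (\<Sum>g\<in>G. h (c g) * g)" using gen by blast
  then obtain c where c: "\<And>i. b * gs ! i = (\<Sum>g\<in>G. h (c i g) * g)" by metis
  define C where "C = Matrix.mat n n (\<lambda>(i,j). c i (gs ! j))"
  have C: "C \<in> carrier_mat n n" by (simp add: C_def)
  define M where "M = map_mat (\<lambda>p. poly p b) (char_poly_matrix (map_mat h C))"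
  have M: "M \<in> carrier_mat n n" using C by (simp add: M_def)
  define v where "v = Matrix.vec n (\<lambda>j. gs ! j)"
  have v: "v \<in> carrier_vec n" by (simp add: v_def)
  have Mv: "M *\<^sub>v v = 0\<^sub>v n"
  proof (rule eq_vecI)
    fix i assume i: "i < dim_vec (0\<^sub>v n :: 'b Matrix.vec)"
    then have i: "i < n" by simp
    have "Matrix.vec_index (M *\<^sub>v v) i = (\<Sum>j<n. ((if i = j then b else 0) - h (c i (gs ! j))) * gs ! j)"
      using i M C by (auto simp: v_def scalar_prod_def M_def char_poly_matrix_def C_def atLeast0LessThan intro!: sum.cong)
    also have "\<dots> = (\<Sum>j<n. if i = j then b * gs ! j else 0) - (\<Sum>j<n. h (c i (gs ! j)) * gs ! j)"
      unfolding sum_subtractf[symmetric] by (rule sum.cong) (auto simp: algebra_simps)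
    also have "(\<Sum>j<n. if i = j then b * gs ! j else 0) = b * gs ! i" using i by simp
    also have "b * gs ! i - (\<Sum>j<n. h (c i (gs ! j)) * gs ! j) = 0" unfolding c sum_gs by simp
    finally show "Matrix.vec_index (M *\<^sub>v v) i = Matrix.vec_index (0\<^sub>v n) i" using i by simp
  qed (use M in simp)
  \<comment> \<open>\<open>M\<close> is the characteristic matrix of \<open>C\<close> evaluated at
    \<open>b\<close>. Since it kills \<open>v\<close>, multiplying by the adjugate shows that its
    determinant kills every generator.\<close>
  let ?d = "Determinant.det M"
  have "?d \<cdot>\<^sub>v v = (?d \<cdot>\<^sub>m 1\<^sub>m n) *\<^sub>v v" 
  proof (rule eq_vecI)
    fix i assume "i < dim_vec ((?d \<cdot>\<^sub>m 1\<^sub>m n) *\<^sub>v v)"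
    then have i: "i < n" by simp
    have "Matrix.vec_index ((?d \<cdot>\<^sub>m 1\<^sub>m n) *\<^sub>v v) i = (\<Sum>j\<in>{0..<n}. if i = j then ?d * gs ! j else 0)"
    proof -
      have "Matrix.vec_index ((?d \<cdot>\<^sub>m 1\<^sub>m n) *\<^sub>v v) i = (\<Sum>j\<in>{0..<n}. ?d * (if j = i then 1 else 0) * gs ! j)"
        using i unfolding v_def by (simp add: scalar_prod_def)
      also have "\<dots> = (\<Sum>j\<in>{0..<n}. if i = j then ?d * gs ! j else 0)"
        by (rule sum.cong) auto
      finally show ?thesis .
    qed
    then show "Matrix.vec_index (?d \<cdot>\<^sub>v v) i = Matrix.vec_index ((?d \<cdot>\<^sub>m 1\<^sub>m n) *\<^sub>v v) i"
      using i by (simp add: v_def)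
  qed (use v in simp)
  also have "\<dots> = (adj_mat M * M) *\<^sub>v v" using adj_mat[OF M] by simp
  also have "\<dots> = adj_mat M *\<^sub>v (M *\<^sub>v v)"
    by (rule assoc_mult_mat_vec[OF adj_mat(1)[OF M] M v])
  also have "\<dots> = 0\<^sub>v n"
    unfolding Mv using adj_mat(1)[OF M] by (intro eq_vecI) (auto simp: scalar_prod_def)
  finally have *: "?d \<cdot>\<^sub>v v = 0\<^sub>v n" .
  have z: "?d * gs ! j = 0" if "j < n" for j
    using arg_cong[OF *, of "\<lambda>w. Matrix.vec_index w j"] that by (simp add: v_def)
  obtain e where e: "1 = (\<Sum>g\<in>G. h (e g) * g)" using gen by blast
  have "?d * 1 = (\<Sum>j<n. h (e (gs ! j)) * (?d * gs ! j))"
    unfolding e sum_gs sum_distrib_left by (simp only: mult.left_commute)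
  also have "\<dots> = 0" using z by (intro sum.neutral) simp
  finally have "?d = 0" by simp
  moreover have "?d = poly (map_poly h (char_poly C)) b"
    unfolding M_def comm_ring_hom.hom_det[OF ev] char_poly_hom[OF C, symmetric]
    unfolding char_poly_def ..
  moreover have "lead_coeff (char_poly C) = 1" using degree_monic_char_poly[OF C] by simp
  ultimately show thesis using that by simp
qed

no_notation Matrix.vec_index (infixl \<open>$\<close> 100)
no_notation fps_nth (infixl \<open>$\<close> 75)

section \<open>Jacobian determinants modulo a prime\<close>

abbreviation mdet :: "'a::comm_ring_1 ^ 'n ^ 'n \<Rightarrow> 'a" where "mdet \<equiv> Determinants.det"

section \<open>Determinants under congruences\<close>

lemma dvd_prod_diff:
  fixes a b :: "'i \<Rightarrow> 'a::comm_ring_1"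
  assumes "finite S" "\<And>i. i \<in> S \<Longrightarrow> q dvd a i - b i"
  shows "q dvd prod a S - prod b S"
  using assms
proof (induction S rule: finite_induct)
  case (insert x S)
  have "a x * prod a S - b x * prod b S = (a x - b x) * prod a S + b x * (prod a S - prod b S)"
    by (simp add: algebra_simps)
  with insert show ?case by simp
qed simp

text \<open>The determinant is a polynomial in the entries and so respects congruences modulo
  \<open>q\<close>; this replaces computing over the quotient ring.\<close>

lemma dvd_det_diff:
  fixes A B :: "'a::comm_ring_1 ^ 'n::finite ^ 'n"
  assumes "\<And>i j. q dvd A $ i $ j - B $ i $ j"
  shows "q dvd mdet A - mdet B"
proof -
  have "mdet A - mdet B = (\<Sum>p | p permutes (UNIV :: 'n set).
      of_int (sign p) * ((\<Prod>i\<in>UNIV. A $ i $ p i) - (\<Prod>i\<in>UNIV. B $ i $ p i)))"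
    unfolding Determinants.det_def sum_subtractf[symmetric] by (simp add: right_diff_distrib)
  also have "q dvd \<dots>" by (intro dvd_sum dvd_mult dvd_prod_diff assms) auto
  finally show ?thesis .
qed

text \<open>Cramer's rule: by linearity in row \<open>k\<close> only the summand
  \<open>l = k\<close> survives, as every other one has two equal rows.\<close>

lemma det_replace_row:
  fixes M :: "'a::comm_ring_1 ^ 'n::finite ^ 'n"
  shows "mdet (\<chi> i j. if i = k then (\<Sum>l\<in>UNIV. c l * M $ l $ j) else M $ i $ j) = c k * mdet M"
proof -
  have "(\<chi> i j. if i = k then (\<Sum>l\<in>UNIV. c l * M $ l $ j) else M $ i $ j) =
      (\<chi> i. if i = k then (\<Sum>l\<in>UNIV. c l *s M $ l) else M $ i)"
    by (auto simp: Finite_Cartesian_Product.vec_eq_iff)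
  also have "mdet \<dots> = (\<Sum>l\<in>UNIV. mdet (\<chi> i. if i = k then c l *s M $ l else M $ i))"
    by (rule Determinants.det_linear_row_sum) simp
  also have "\<dots> = (\<Sum>l\<in>UNIV. if l = k then c k * mdet M else 0)"
  proof (rule sum.cong[OF refl])
    fix l
    have "mdet (\<chi> i. if i = k then c l *s M $ l else M $ i) = c l * mdet (\<chi> i. if i = k then M $ l else M $ i)"
      by (rule Determinants.det_row_mul)
    also have "mdet (\<chi> i. if i = k then M $ l else M $ i) = (if l = k then mdet M else 0)"
    proof (cases "l = k")
      case True
      then have "(\<chi> i. if i = k then M $ l else M $ i) = M" by (auto simp: Finite_Cartesian_Product.vec_eq_iff)
      with True show ?thesis by simp
    next
      case False
      then have "mdet (\<chi> i. if i = k then M $ l else M $ i) = 0"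
        by (intro Determinants.det_identical_rows[of k l]) (auto simp: Finite_Cartesian_Product.row_def)
      with False show ?thesis by simp
    qed
    finally show "mdet (\<chi> i. if i = k then c l *s M $ l else M $ i) = (if l = k then c k * mdet M else 0)"
      by auto
  qed
  also have "\<dots> = c k * mdet M" by simp
  finally show ?thesis .
qed

text \<open>
  The rows of \<open>M\<close> span multiples \<open>d e\<^sub>j\<close>, with \<open>d\<close> nonzero modulo \<open>q\<close>, of all unit vectors modulo
  \<open>q\<close>; so \<open>S M\<close> is diagonal modulo \<open>q\<close> for some \<open>S\<close>.
\<close>

lemma not_dvd_det_if_spanning:
  fixes M :: "'a::comm_ring_1 ^ 'n::finite ^ 'n"
  assumes prime: "\<And>a b. q dvd a * b \<Longrightarrow> q dvd a \<or> q dvd b" and unit: "\<not> q dvd 1"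
    and span: "\<And>j. \<exists>d s. \<not> q dvd d \<and> (\<forall>k. q dvd (if j = k then d else 0) - (\<Sum>i\<in>UNIV. s i * M $ i $ k))"
  shows "\<not> q dvd mdet M"
proof
  assume *: "q dvd mdet M"
  from span obtain d s where d: "\<And>j. \<not> q dvd d j"
    and s: "\<And>j k. q dvd (if j = k then d j else 0) - (\<Sum>i\<in>UNIV. s j i * M $ i $ k)" by metis
  define D where "D = (\<chi> j k. if j = k then d j else 0)"
  define S where "S = (\<chi> j i. s j i)"
  have "q dvd mdet D - mdet (S ** M)"
    by (rule dvd_det_diff) (use s in \<open>simp add: D_def S_def matrix_matrix_mult_def\<close>)
  then have "q dvd mdet D - mdet S * mdet M" by (simp add: Determinants.det_mul)
  with * have "q dvd mdet D" by (metis diff_add_cancel dvd_add dvd_mult)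
  also have "mdet D = (\<Prod>j\<in>UNIV. d j)" by (subst Determinants.det_diagonal) (auto simp: D_def)
  finally have "q dvd (\<Prod>j\<in>UNIV. d j)" .
  moreover have "\<not> q dvd (\<Prod>j\<in>J. d j)" if "finite J" for J
    using that
  proof (induction J rule: finite_induct)
    case (insert x J)
    then show ?case using prime d by auto
  qed (use unit in simp)
  ultimately show False by (metis finite)
qed

section \<open>Gradients of integral equations\<close>

lemma map_poly_subst_pCons [simp]:
  "map_poly (subst f) (pCons c h) = pCons (subst f c) (map_poly (subst f) h)"
  by (rule poly_eqI) (simp add: coeff_map_poly coeff_pCons split: nat.split)

text \<open>The coefficients are polynomials in the \<open>f i\<close>, so by the chain rule their
  derivatives contribute a combination of the gradients of the \<open>f i\<close>. It matters that
  \<open>s\<close> does not depend on the direction \<open>k\<close>: this is an identity of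
  vectors.\<close>

lemma partial_deriv_poly_subst:
  fixes f :: "'n::{finite,linorder} \<Rightarrow> 'n cpoly"
  shows "\<exists>s. \<forall>k. partial_deriv k (poly (map_poly (subst f) g) b) =
    poly (map_poly (subst f) (pderiv g)) b * partial_deriv k b + (\<Sum>i\<in>UNIV. s i * partial_deriv k (f i))"
proof (induction g)
  case 0
  show ?case by (intro exI[of _ "\<lambda>_. 0"]) simp
next
  case (pCons a g)
  then obtain s where s: "\<And>k. partial_deriv k (poly (map_poly (subst f) g) b) =
    poly (map_poly (subst f) (pderiv g)) b * partial_deriv k b + (\<Sum>i\<in>UNIV. s i * partial_deriv k (f i))" by blast
  have ma: "map_poly (subst f) (p + q) = map_poly (subst f) p + map_poly (subst f) q" for p q
    by (rule poly_eqI) (simp add: coeff_map_poly subst_add)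
  show ?case
  proof (intro exI allI)
    fix k
    show "partial_deriv k (poly (map_poly (subst f) (pCons a g)) b) =
      poly (map_poly (subst f) (pderiv (pCons a g))) b * partial_deriv k b +
      (\<Sum>i\<in>UNIV. (subst f (partial_deriv i a) + b * s i) * partial_deriv k (f i))"
      by (simp add: ma pderiv_pCons partial_deriv_add partial_deriv_mult s partial_deriv_chain
          distrib_right distrib_left sum.distrib sum_distrib_left mult.assoc)
  qed
qed

text \<open>Made monic, the derivative becomes a competitor of smaller degree for a polynomial
  chosen with minimal degree.\<close>

lemma lead_coeff_smult_pderiv:
  fixes g :: "'n::linorder cpoly poly"
  assumes "lead_coeff g = 1" "Polynomial.degree g \<noteq> 0"
  defines "h \<equiv> Polynomial.smult (const_poly (1 / of_nat (Polynomial.degree g))) (pderiv g)"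
  shows "lead_coeff h = 1" "Polynomial.degree h < Polynomial.degree g"
proof -
  have d: "Polynomial.degree (pderiv g) \<le> Polynomial.degree g - 1"
    by (rule degree_le) (use coeff_eq_0[of g] in \<open>auto simp: coeff_pderiv\<close>)
  then have dh: "Polynomial.degree h \<le> Polynomial.degree g - 1"
    unfolding h_def using degree_smult_le le_trans by blast
  have c: "coeff h (Polynomial.degree g - 1) = 1"
    using assms(1,2) unfolding h_def
    by (simp add: coeff_pderiv of_nat_eq_const_poly del: of_nat_Suc flip: const_poly_mult)
  then have "Polynomial.degree g - 1 \<le> Polynomial.degree h" by (intro le_degree) simp
  with dh have "Polynomial.degree h = Polynomial.degree g - 1" by simp
  with c assms(2) show "lead_coeff h = 1" "Polynomial.degree h < Polynomial.degree g" by simp_all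
qed

text \<open>A nonzero partial derivative exists because \<open>p\<close> is not constant, and its
  \<open>sum_deg\<close> is too small for a multiple of \<open>p\<close>.\<close>

lemma ex_partial_deriv_not_dvd:
  fixes p :: "'n::{finite,linorder} cpoly"
  assumes "prime_elem p"
  shows "\<exists>i. \<not> p dvd partial_deriv i p \<and> deg i p \<noteq> 0"
proof -
  have p: "p \<noteq> 0" "\<not> p dvd 1" using assms by (auto simp: prime_elem_def)
  then have "sum_deg p \<noteq> 0" using dvd_1_iff[of p] by simp
  then obtain i where i: "deg i p \<noteq> 0" by (auto simp: sum_deg_def)
  then have nz: "partial_deriv i p \<noteq> 0" using partial_deriv_eq_0_iff[of i p] by simp
  have "\<not> p dvd partial_deriv i p"
  proof
    assume "p dvd partial_deriv i p"
    then obtain g where g: "partial_deriv i p = p * g" ..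
    with nz have "g \<noteq> 0" by auto
    with sum_deg_mult[OF p(1) this] sum_deg_partial_deriv_less[OF nz] g show False by simp
  qed
  with i show ?thesis by blast
qed

text \<open>Integrality of B over A. The polynomial \<open>g\<close> has coefficients in the source
  of \<open>subst f\<close>, so that formal derivatives make sense before \<open>subst f\<close> is
  known to be injective.\<close>

locale finite_subst =
  fixes f :: "'n::{finite,linorder} \<Rightarrow> 'n cpoly"
  assumes integral: "\<exists>g. lead_coeff g = 1 \<and> poly (map_poly (subst f) g) b = 0"
begin

abbreviation J where "J \<equiv> jacobian f"

text \<open>
  A monic polynomial of minimal degree vanishing modulo \<open>q\<close> at \<open>b\<close> has a derivative which does not,
  since the derivative is a scalar multiple of a monic polynomial of smaller degree.
\<close>

lemma separable:
  assumes "\<not> q dvd 1"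
  obtains g where "q dvd poly (map_poly (subst f) g) b" "\<not> q dvd poly (map_poly (subst f) (pderiv g)) b"
proof -
  let ?P = "\<lambda>g. lead_coeff g = 1 \<and> q dvd poly (map_poly (subst f) g) b"
  from integral[of b] obtain g0 where "lead_coeff g0 = 1" "poly (map_poly (subst f) g0) b = 0" by blast
  then have "?P g0" by simp
  from ex_has_least_nat[of ?P, OF this, of Polynomial.degree]
  obtain g where g: "?P g" and min: "\<And>h. ?P h \<Longrightarrow> Polynomial.degree g \<le> Polynomial.degree h"
    by blast
  have "\<not> q dvd poly (map_poly (subst f) (pderiv g)) b"
  proof
    assume *: "q dvd poly (map_poly (subst f) (pderiv g)) b"
    have "Polynomial.degree g \<noteq> 0"
    proof
      assume d: "Polynomial.degree g = 0"
      with g have "g = 1" by (metis degree_eq_zeroE lead_coeff_pCons(2) one_pCons)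
      with g assms show False by simp
    qed
    note h = lead_coeff_smult_pderiv[OF conjunct1[OF g] this]
    have "q dvd poly (map_poly (subst f) (Polynomial.smult (const_poly c) (pderiv g))) b" for c
      using * by (subst map_poly_smult) (simp_all add: subst_mult)
    with h min show False by fastforce
  qed
  with g that show thesis by blast
qed

text \<open>The gradient of \<open>g(X_j) = q * h\<close> is computed in two ways: modulo
  \<open>q\<close> the right side gives \<open>h\<close> times the gradient of \<open>q\<close>, and
  the left side is \<open>g'(X_j)\<close> times the \<open>j\<close>-th unit vector plus a
  combination of the gradients of the \<open>f i\<close>. Thus \<open>d\<close> is
  \<open>g'(X_j)\<close>.\<close>

lemma spanning_mod:
  assumes "\<not> q dvd 1"
  shows "\<exists>d s h. \<not> q dvd d \<and>
    (\<forall>k. q dvd (if j = k then d else 0) - ((\<Sum>i\<in>UNIV. s i * partial_deriv k (f i)) + h * partial_deriv k q))"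
proof -
  obtain g where g: "q dvd poly (map_poly (subst f) g) (Var j)"
    "\<not> q dvd poly (map_poly (subst f) (pderiv g)) (Var j)" (is "\<not> q dvd ?d") using separable[OF assms] .
  obtain s where s: "\<And>k. partial_deriv k (poly (map_poly (subst f) g) (Var j)) =
    ?d * partial_deriv k (Var j) + (\<Sum>i\<in>UNIV. s i * partial_deriv k (f i))"
    using partial_deriv_poly_subst by blast
  from g(1) obtain h where h: "poly (map_poly (subst f) g) (Var j) = q * h" ..
  have "(if j = k then ?d else 0) - ((\<Sum>i\<in>UNIV. (- s i) * partial_deriv k (f i)) + h * partial_deriv k q) =
    q * partial_deriv k h" for k
    using s[of k] unfolding h partial_deriv_mult partial_deriv_Var
    by (auto simp: sum_negf algebra_simps split: if_splits)
  then show ?thesis using g(2) by (intro exI[of _ ?d] exI[of _ "\<lambda>i. - s i"] exI[of _ h]) simp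
qed

text \<open>The case \<open>q = 0\<close>: congruence modulo 0 is equality, the gradient of
  \<open>q\<close> vanishes, and 0 has the required primality as the ring is a domain.\<close>

lemma jacobian_neq_0: "J \<noteq> 0"
proof -
  have "\<not> 0 dvd J"
    unfolding jacobian_def
  proof (rule not_dvd_det_if_spanning)
    show "\<exists>d s. \<not> 0 dvd d \<and> (\<forall>k. 0 dvd (if j = k then d else 0) -
      (\<Sum>i\<in>UNIV. s i * (\<chi> i j. partial_deriv j (f i)) $ i $ k))" for j
      using spanning_mod[of 0 j] by simp
  qed auto
  then show ?thesis by simp
qed

lemma gradient_subst_det:
  "mdet (\<chi> i j. if i = k then partial_deriv j (subst f p) else partial_deriv j (f i)) =
    subst f (partial_deriv k p) * J"
  using det_replace_row[of k "\<lambda>l. subst f (partial_deriv l p)" "\<chi> i j. partial_deriv j (f i)"]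
  by (simp add: partial_deriv_chain jacobian_def cong: if_cong)

text \<open>Since \<open>J\<close> is nonzero, Cramer's rule turns the partial derivatives of a
  relation into relations, so one of minimal \<open>sum_deg\<close> would be a nonzero
  constant.\<close>

lemma subst_eq_0_iff: "subst f p = 0 \<longleftrightarrow> p = 0"
proof (rule ccontr)
  assume "\<not> ?thesis"
  then obtain p0 where "p0 \<noteq> 0 \<and> subst f p0 = 0" by (cases "p = 0") auto
  from ex_has_least_nat[of "\<lambda>p. p \<noteq> 0 \<and> subst f p = 0", OF this, of sum_deg]
  obtain p where p: "p \<noteq> 0" "subst f p = 0"
    and min: "\<And>q. q \<noteq> 0 \<Longrightarrow> subst f q = 0 \<Longrightarrow> sum_deg p \<le> sum_deg q"
    by blast
  have "deg k p = 0" for k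
  proof (rule ccontr)
    assume "deg k p \<noteq> 0"
    then have nz: "partial_deriv k p \<noteq> 0" using partial_deriv_eq_0_iff[of k p] by simp
    have "subst f (partial_deriv k p) * J =
        mdet (\<chi> i j. if i = k then (\<Sum>l\<in>UNIV. 0 * partial_deriv j (f l)) else partial_deriv j (f i))"
      unfolding gradient_subst_det[symmetric] p(2) by (simp cong: if_cong)
    also have "\<dots> = 0"
      using det_replace_row[of k "\<lambda>_. 0" "\<chi> i j. partial_deriv j (f i)"] by (simp cong: if_cong)
    finally have "subst f (partial_deriv k p) = 0" using jacobian_neq_0 by simp
    with min[OF nz] sum_deg_partial_deriv_less[OF nz] show False by simp
  qed
  then have "sum_deg p = 0" by (simp add: sum_deg_def)
  then obtain c where "p = const_poly c" unfolding sum_deg_eq_0_iff by blast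
  with p show False by simp
qed

lemma inj_subst: "inj (subst f)"
  by (rule injI) (metis subst.hom_minus subst_eq_0_iff right_minus_eq)

end

section \<open>A prime of B and its contraction\<close>

locale prime_over = finite_subst f for f :: "'n::{finite,linorder} \<Rightarrow> 'n cpoly" +
  fixes q :: "'n cpoly"
  assumes prime: "prime_elem q"
begin

lemma not_dvd_1: "\<not> q dvd 1"
  using prime by (simp add: prime_elem_def)

lemma not_dvd_const: "c \<noteq> 0 \<Longrightarrow> \<not> q dvd const_poly c"
  using not_dvd_1 const_poly_dvd_1 dvd_trans by blast

text \<open>The Jacobian matrix of the family \<open>f\<close> with \<open>f i\<close> exchanged for
  \<open>q\<close>.\<close>

definition conormal where
  "conormal i = (\<chi> r k. if r = i then partial_deriv k q else partial_deriv k (f r))"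

text \<open>Modulo \<open>q\<close> the gradients of all \<open>f r\<close> and of \<open>q\<close>
  span, one vector too many. The gradient of \<open>subst f p\<close> is a multiple of that of
  \<open>q\<close> modulo \<open>q\<close>, and as \<open>?p i\<close> is nonzero modulo
  \<open>q\<close> this relation eliminates the gradient of \<open>f i\<close>.\<close>

lemma not_dvd_conormal_det:
  assumes p: "q dvd subst f p" and i: "\<not> q dvd subst f (partial_deriv i p)"
  shows "\<not> q dvd mdet (conormal i)"
proof (rule not_dvd_det_if_spanning)
  fix j
  let ?p = "\<lambda>r. subst f (partial_deriv r p)" and ?f = "\<lambda>r k. partial_deriv k (f r)"
  from p obtain t where t: "subst f p = q * t" ..
  obtain d s h where d: "\<not> q dvd d" and
    s: "\<And>k. q dvd (if j = k then d else 0) - ((\<Sum>r\<in>UNIV. s r * ?f r k) + h * partial_deriv k q)"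
    using spanning_mod[OF not_dvd_1, of j] by blast
  \<comment> \<open>The relation for \<open>d\<close> is multiplied by \<open>?p i\<close>; then
    \<open>?p i\<close> times the gradient of \<open>f i\<close> is replaced by \<open>t\<close>
    times the gradient of \<open>q\<close> minus the terms \<open>?p r\<close> times the gradient of
    \<open>f r\<close> for the other \<open>r\<close>.\<close>
  let ?s = "\<lambda>r. if r = i then ?p i * h + s i * t else ?p i * s r - s i * ?p r"
  have 3: "q dvd (if j = k then ?p i * d else 0) - (\<Sum>r\<in>UNIV. ?s r * conormal i $ r $ k)" for k
  proof -
    let ?A = "\<Sum>r\<in>UNIV - {i}. s r * ?f r k" and ?B = "\<Sum>r\<in>UNIV - {i}. ?p r * ?f r k"
    have split: "(\<Sum>r\<in>UNIV. F r) = F i + (\<Sum>r\<in>UNIV - {i}. F r)" for F :: "'n \<Rightarrow> 'n cpoly"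
      by (rule sum.remove) auto
    have "(\<Sum>r\<in>UNIV. ?s r * conormal i $ r $ k) =
        (?p i * h + s i * t) * partial_deriv k q + (\<Sum>r\<in>UNIV - {i}. (?p i * s r - s i * ?p r) * ?f r k)"
      unfolding split by (simp add: conormal_def)
    also have "(\<Sum>r\<in>UNIV - {i}. (?p i * s r - s i * ?p r) * ?f r k) = ?p i * ?A - s i * ?B"
      by (simp add: sum_distrib_left sum_subtractf algebra_simps)
    finally have 1: "(\<Sum>r\<in>UNIV. ?s r * conormal i $ r $ k) =
        (?p i * h + s i * t) * partial_deriv k q + (?p i * ?A - s i * ?B)" .
    have "?p i * ?f i k + ?B = partial_deriv k (subst f p)"
      unfolding partial_deriv_chain split[of "\<lambda>r. ?p r * ?f r k"] ..
    then have 2: "?p i * ?f i k = partial_deriv k q * t + q * partial_deriv k t - ?B"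
      unfolding t partial_deriv_mult by (simp add: algebra_simps)
    obtain w where w: "(if j = k then d else 0) - ((s i * ?f i k + ?A) + h * partial_deriv k q) = q * w"
      using s[of k] unfolding split[of "\<lambda>r. s r * ?f r k"] dvd_def by blast
    have "(if j = k then ?p i * d else 0) - (\<Sum>r\<in>UNIV. ?s r * conormal i $ r $ k) =
        ?p i * (if j = k then d else 0) - ((?p i * h + s i * t) * partial_deriv k q + (?p i * ?A - s i * ?B))"
      unfolding 1 by simp
    also have "\<dots> = ?p i * ((if j = k then d else 0) - ((s i * ?f i k + ?A) + h * partial_deriv k q))
        + s i * (?p i * ?f i k) + s i * ?B - s i * t * partial_deriv k q"
      by (simp add: algebra_simps)
    also have "\<dots> = q * (?p i * w + s i * partial_deriv k t)"
      unfolding w 2 by (simp add: algebra_simps)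
    finally show ?thesis by simp
  qed
  have 4: "\<not> q dvd ?p i * d" using i d prime prime_elem_dvd_mult_iff by blast
  show "\<exists>d s. \<not> q dvd d \<and> (\<forall>k. q dvd (if j = k then d else 0) - (\<Sum>r\<in>UNIV. s r * conormal i $ r $ k))"
    by (intro exI[of _ "?p i * d"] exI[of _ ?s] conjI allI 3 4)
qed (rule prime_elem_dvd_multD[OF prime], assumption, rule not_dvd_1)

text \<open>In an integral equation for \<open>q\<close> the constant term is divisible by
  \<open>q\<close>. If it is 0, a factor \<open>q\<close> is cancelled and the equation stays
  monic.\<close>

lemma ex_nonzero_below: "\<exists>p. p \<noteq> 0 \<and> q dvd subst f p"
proof -
  obtain g where "lead_coeff g = 1" "poly (map_poly (subst f) g) q = 0" using integral by blast
  then show ?thesis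
  proof (induction g)
    case (pCons a g)
    have eq: "subst f a + q * poly (map_poly (subst f) g) q = 0"
      using pCons.prems(2) by simp
    show ?case
    proof (cases "a = 0")
      case True
      with pCons have "g \<noteq> 0" by auto
      with pCons.prems(1) have "lead_coeff g = 1" by simp
      moreover have "poly (map_poly (subst f) g) q = 0" using eq True prime by simp
      ultimately show ?thesis by (rule pCons.IH)
    next
      case False
      from eq have "subst f a = q * - poly (map_poly (subst f) g) q"
        by (simp add: eq_neg_iff_add_eq_0)
      then have "q dvd subst f a" by (rule dvdI)
      with False show ?thesis by blast
    qed
  qed simp
qed

text \<open>
  The prime \<open>q\<close> contracts to a principal prime \<open>(p)\<close>. Otherwise it contains the images of \<open>p\<close> and of
  a nonzero polynomial \<open>g\<close> free of a variable \<open>X\<^sub>i\<close> occurring in \<open>p\<close>. Modulo \<open>q\<close> the gradient of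
  \<open>g(f)\<close> is proportional to that of \<open>q\<close>, so the independence of the rows of \<open>conormal i\<close> shows that the
  partial derivatives of \<open>g\<close> are again of this kind, and one descends to a nonzero constant.
\<close>

lemma ex_prime_below:
  obtains p where "prime_elem p" "\<And>g. q dvd subst f g \<longleftrightarrow> p dvd g"
proof -
  obtain p0 where "p0 \<noteq> 0 \<and> q dvd subst f p0" using ex_nonzero_below by blast
  from ex_has_least_nat[of "\<lambda>p. p \<noteq> 0 \<and> q dvd subst f p", OF this, of sum_deg]
  obtain p where p: "p \<noteq> 0" "q dvd subst f p"
    and min: "\<And>g. g \<noteq> 0 \<Longrightarrow> q dvd subst f g \<Longrightarrow> sum_deg p \<le> sum_deg g"
    by blast
  have nconst: "sum_deg g \<noteq> 0" if "g \<noteq> 0" "q dvd subst f g" for g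
  proof
    assume "sum_deg g = 0"
    then obtain c where "g = const_poly c" unfolding sum_deg_eq_0_iff by blast
    with that not_dvd_const[of c] show False by auto
  qed
  have "irreducible p"
  proof (rule irreducibleI[OF p(1)])
    show "\<not> p dvd 1" using dvd_1_iff[of p] nconst[OF p] by simp
  next
    have *: "b dvd 1" if ab: "p = a * b" and a: "q dvd subst f a" for a b
    proof -
      from ab p(1) have nz: "a \<noteq> 0" "b \<noteq> 0" by auto
      with min[OF nz(1) a] sum_deg_mult[OF nz] ab show ?thesis using dvd_1_iff[of b] by simp
    qed
    fix a b assume ab: "p = a * b"
    with p(2) have "q dvd subst f a \<or> q dvd subst f b"
      using prime_elem_dvd_multD[OF prime] by (simp add: subst_mult)
    then show "a dvd 1 \<or> b dvd 1" using *[of a b] *[of b a] ab by (auto simp: mult.commute)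
  qed
  then have pp: "prime_elem p" by (rule irreducible_imp_prime_elem)
  obtain i where "\<not> p dvd partial_deriv i p" and i: "deg i p \<noteq> 0"
    using ex_partial_deriv_not_dvd[OF pp] by blast
  then have nz: "partial_deriv i p \<noteq> 0" by auto
  then have npi: "\<not> q dvd subst f (partial_deriv i p)"
    using min[OF nz] sum_deg_partial_deriv_less[OF nz] by auto
  have 1: "p dvd g" if g: "q dvd subst f g" for g
  proof (rule ccontr)
    assume "\<not> p dvd g"
    then obtain h u v where h: "h \<noteq> 0" "deg i h = 0" "h = u * p + v * g"
      using bezout_in_Var[OF pp i] by metis
    have "q dvd subst f h" unfolding h(3) subst_add subst_mult using p(2) g by simp
    with h have "h \<noteq> 0 \<and> deg i h = 0 \<and> q dvd subst f h" by blast
    from ex_has_least_nat[of "\<lambda>h. h \<noteq> 0 \<and> deg i h = 0 \<and> q dvd subst f h", OF this, of sum_deg]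
    obtain h where h: "h \<noteq> 0" "deg i h = 0" "q dvd subst f h"
      and hmin: "\<And>g. g \<noteq> 0 \<Longrightarrow> deg i g = 0 \<Longrightarrow> q dvd subst f g \<Longrightarrow> sum_deg h \<le> sum_deg g"
      by blast
    have "deg j h = 0" for j
    proof (rule ccontr)
      assume j: "deg j h \<noteq> 0"
      with h(2) have "j \<noteq> i" by auto
      from h(3) obtain t where t: "subst f h = q * t" ..
      let ?M = "conormal i"
      let ?c = "\<lambda>r. subst f (partial_deriv r h)"
      \<comment> \<open>As \<open>h\<close> is free of \<open>X_i\<close>, its gradient after
        substitution does not see row \<open>i\<close>, the only row in which
        \<open>conormal i\<close> differs from the Jacobian matrix.\<close>
      have ci: "?c i = 0" using h(2) partial_deriv_eq_0_iff[of i h] by simp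
      have row: "(\<Sum>r\<in>UNIV. ?c r * ?M $ r $ k) = partial_deriv k q * t + q * partial_deriv k t" for k
      proof -
        have "(\<Sum>r\<in>UNIV. ?c r * ?M $ r $ k) = (\<Sum>r\<in>UNIV. ?c r * partial_deriv k (f r))"
          by (rule sum.cong) (auto simp: conormal_def ci)
        also have "\<dots> = partial_deriv k q * t + q * partial_deriv k t"
          unfolding partial_deriv_chain[symmetric] t partial_deriv_mult ..
        finally show ?thesis .
      qed
      have row': "(\<Sum>r\<in>UNIV. (if r = i then t else 0) * ?M $ r $ k) = partial_deriv k q * t" for k
        by (simp add: conormal_def if_distrib[of "\<lambda>x. x * _"] cong: if_cong)
      \<comment> \<open>Both matrices have row \<open>j\<close> of \<open>?M\<close> replaced, by
        vectors congruent modulo \<open>q\<close>. Cramer's rule evaluates the first determinant to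
        \<open>?c j * mdet ?M\<close> and the second to 0, its coefficient at \<open>j\<close> being
        0 because \<open>j\<close> differs from \<open>i\<close>.\<close>
      have "q dvd mdet (\<chi> r k. if r = j then (\<Sum>r\<in>UNIV. ?c r * ?M $ r $ k) else ?M $ r $ k) -
          mdet (\<chi> r k. if r = j then (\<Sum>r\<in>UNIV. (if r = i then t else 0) * ?M $ r $ k) else ?M $ r $ k)"
        unfolding row row' by (rule dvd_det_diff) simp
      then have "q dvd ?c j * mdet ?M"
        unfolding det_replace_row using \<open>j \<noteq> i\<close> by simp
      then have "q dvd ?c j"
        using not_dvd_conormal_det[OF p(2) npi] prime prime_elem_dvd_multD by blast
      moreover have nz: "partial_deriv j h \<noteq> 0" using j partial_deriv_eq_0_iff[of j h] by simp
      moreover have "deg i (partial_deriv j h) = 0" using deg_partial_deriv_le[of i j h] h(2) by simp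
      ultimately have "sum_deg h \<le> sum_deg (partial_deriv j h)" using hmin by blast
      with sum_deg_partial_deriv_less[OF nz] show False by simp
    qed
    then have "sum_deg h = 0" by (simp add: sum_deg_def)
    with nconst[OF h(1,3)] show False ..
  qed
  have 2: "q dvd subst f g" if "p dvd g" for g
  proof -
    from that obtain h where "g = p * h" ..
    with p(2) show ?thesis by (simp add: subst_mult)
  qed
  show thesis by (rule that[OF pp iffI[OF 1 2]])
qed

text \<open>With the exponent written as \<open>Suc n\<close>, \<open>e - 1\<close> is simply
  \<open>n\<close>. Some partial derivative of \<open>p\<close> is not divisible by
  \<open>p\<close>, so its substitution \<open>?P\<close> is not divisible by \<open>q\<close>, and
  the factor \<open>?P\<close> in \<open>?P * J\<close> leaves the multiplicity of \<open>q\<close>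
  unchanged.\<close>

lemma jacobian_multiplicity:
  assumes below: "prime_elem p" "\<And>g. q dvd subst f g \<longleftrightarrow> p dvd g"
    and e: "subst f p = q ^ Suc n * r" "\<not> q dvd r"
  shows "q ^ n dvd J \<and> \<not> q ^ Suc n dvd J"
proof -
  obtain i where i: "\<not> q dvd subst f (partial_deriv i p)"
    using ex_partial_deriv_not_dvd[OF below(1)] below(2) by blast
  let ?P = "subst f (partial_deriv i p)"
  have p: "q dvd subst f p" unfolding e by simp
  define w where "w k = of_nat (Suc n) * r * partial_deriv k q + q * partial_deriv k r" for k
  have grad: "partial_deriv k (subst f p) = q ^ n * w k" for k
    unfolding e partial_deriv_mult partial_deriv_power w_def by (simp add: algebra_simps)
  let ?W = "\<chi> r k. if r = i then w k else partial_deriv k (f r)"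
  have "?P * J = mdet (\<chi> r. if r = i then q ^ n *s (\<chi> k. w k) else (\<chi> k. partial_deriv k (f r)))"
    unfolding gradient_subst_det[symmetric] grad
    by (rule arg_cong[of _ _ mdet]) (auto simp: Finite_Cartesian_Product.vec_eq_iff)
  also have "\<dots> = q ^ n * mdet (\<chi> r. if r = i then (\<chi> k. w k) else (\<chi> k. partial_deriv k (f r)))"
    by (rule Determinants.det_row_mul)
  also have "(\<chi> r. if r = i then (\<chi> k. w k) else (\<chi> k. partial_deriv k (f r))) = ?W"
    by (auto simp: Finite_Cartesian_Product.vec_eq_iff)
  finally have PJ: "?P * J = q ^ n * mdet ?W" .
  \<comment> \<open>Modulo \<open>q\<close>, the vector \<open>w\<close> is
    \<open>of_nat (Suc n) * r\<close> times the gradient of \<open>q\<close>, so \<open>?W\<close>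
    is congruent to \<open>conormal i\<close> with row \<open>i\<close> scaled by this
    factor.\<close>
  let ?c = "\<lambda>l. if l = i then of_nat (Suc n) * r else 0"
  have "q dvd mdet ?W - mdet (\<chi> r k. if r = i then (\<Sum>l\<in>UNIV. ?c l * conormal i $ l $ k) else conormal i $ r $ k)"
    by (rule dvd_det_diff) (auto simp: conormal_def w_def if_distrib[of "\<lambda>x. x * _"] cong: if_cong)
  then have W: "q dvd mdet ?W - (of_nat (Suc n) * r) * mdet (conormal i)"
    unfolding det_replace_row by simp
  have "\<not> q dvd of_nat (Suc n)" unfolding of_nat_eq_const_poly by (rule not_dvd_const) (simp del: of_nat_Suc)
  then have nd: "\<not> q dvd (of_nat (Suc n) * r) * mdet (conormal i)"
    using e(2) not_dvd_conormal_det[OF p i] prime_elem_dvd_mult_iff[OF prime] by blast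
  have nW: "\<not> q dvd mdet ?W"
  proof
    assume "q dvd mdet ?W"
    from dvd_diff[OF this W] have "q dvd (of_nat (Suc n) * r) * mdet (conormal i)"
      by (simp only: diff_diff_eq2 add_diff_cancel_left')
    with nd show False ..
  qed
  have "q ^ n dvd ?P * J" unfolding PJ by simp
  then have "q ^ n dvd J" using prime_elem_power_dvd_mult_cancel[OF prime i] by blast
  moreover have "\<not> q ^ Suc n dvd J"
  proof
    assume "q ^ Suc n dvd J"
    then have "q ^ n * q dvd q ^ n * mdet ?W" unfolding PJ[symmetric] by (simp add: mult.commute)
    moreover have "q \<noteq> 0" using prime by auto
    ultimately have "q dvd mdet ?W" by simp
    with nW show False ..
  qed
  ultimately show ?thesis ..
qed

end

section \<open>Height one primes\<close>

lemma cpoly_ring_simps [simp]: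
  "carrier cpoly_ring = UNIV"
  "x \<oplus>\<^bsub>cpoly_ring\<^esub> y = x + y" "x \<otimes>\<^bsub>cpoly_ring\<^esub> y = x * y"
  "\<zero>\<^bsub>cpoly_ring\<^esub> = 0" "\<one>\<^bsub>cpoly_ring\<^esub> = 1"
  for x y :: "'n cpoly"
  by (simp_all add: ring_of_type_algebra_def)

lemma cring_cpoly_ring: "cring (cpoly_ring :: 'n cpoly ring)"
  by (rule cring_from_type_algebra)

lemma ring_cpoly_ring: "ring (cpoly_ring :: 'n cpoly ring)"
  by (rule ring_from_type_algebra)

lemma a_inv_cpoly_ring [simp]: "\<ominus>\<^bsub>cpoly_ring\<^esub> x = - x" for x :: "'n cpoly"
  by (rule abelian_group.minus_equality[OF ring.is_abelian_group[OF ring_cpoly_ring]]) simp_all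

lemma subring_of_UNIV: "subring_of UNIV = (cpoly_ring :: 'n cpoly ring)"
  by (simp add: ring_of_type_algebra_def)

lemma subalgebra_gen_eq_range: "subalgebra_gen f = range (subst f)" for f :: "'n::finite \<Rightarrow> 'n cpoly"
proof (intro subset_antisym subsetI)
  fix x assume "x \<in> subalgebra_gen f"
  then show "x \<in> range (subst f)"
    unfolding subalgebra_gen_def
  proof (induction rule: generate_ring.induct)
    case one
    show ?case using rangeI[of "subst f" 1] by (simp only: subst_1 cpoly_ring_simps)
  next
    case (incl h)
    then show ?case
    proof
      assume "h \<in> range const_poly"
      then obtain c where "h = subst f (const_poly c)" by auto
      then show ?thesis by blast
    next
      assume "h \<in> range f"
      then obtain i where "h = subst f (Var i)" by auto
      then show ?thesis by blast
    qed
  next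
    case (a_inv h)
    then obtain p where "h = subst f p" by blast
    then have "\<ominus>\<^bsub>cpoly_ring\<^esub> h = subst f (- p)" by (simp add: subst.hom_uminus)
    then show ?case by blast
  next
    case (eng_add h1 h2)
    then obtain p q where "h1 = subst f p" "h2 = subst f q" by blast
    then have "h1 \<oplus>\<^bsub>cpoly_ring\<^esub> h2 = subst f (p + q)" by (simp add: subst_add)
    then show ?case by blast
  next
    case (eng_mult h1 h2)
    then obtain p q where "h1 = subst f p" "h2 = subst f q" by blast
    then have "h1 \<otimes>\<^bsub>cpoly_ring\<^esub> h2 = subst f (p * q)" by (simp add: subst_mult)
    then show ?case by blast
  qed
next
  fix x assume "x \<in> range (subst f)"
  then obtain p where "x = subst f p" by blast
  moreover have "subst f p \<in> generate_ring cpoly_ring (range const_poly \<union> range f)"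
  proof (induction p rule: cpoly_induct)
    case (const c)
    then show ?case by (auto intro: generate_ring.incl)
  next
    case (Var i)
    then show ?case by (auto intro: generate_ring.incl)
  next
    case (add p q)
    from generate_ring.eng_add[OF this] show ?case by (simp add: subst_add)
  next
    case (mult p q)
    from generate_ring.eng_mult[OF this] show ?case by (simp add: subst_mult)
  qed
  ultimately show "x \<in> subalgebra_gen f" by (simp add: subalgebra_gen_def)
qed

lemma module_finite_imp_finite_subst:
  fixes f :: "'n::{finite,linorder} \<Rightarrow> 'n cpoly"
  assumes "module_finite_over (range (subst f))"
  shows "finite_subst f"
proof
  fix b
  from assms obtain G where G: "finite G"
    "\<And>b. \<exists>c. (\<forall>g\<in>G. c g \<in> range (subst f)) \<and> b = (\<Sum>g\<in>G. c g * g)"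
    unfolding module_finite_over_def by blast
  have gen: "\<exists>c. b = (\<Sum>g\<in>G. subst f (c g) * g)" for b
  proof -
    from G(2)[of b] obtain c where c: "\<forall>g\<in>G. c g \<in> range (subst f)" "b = (\<Sum>g\<in>G. c g * g)" by blast
    from c(1) have "\<forall>g\<in>G. \<exists>d. c g = subst f d" by blast
    then obtain d where "\<And>g. g \<in> G \<Longrightarrow> c g = subst f (d g)" by metis
    with c(2) show ?thesis by (intro exI[of _ d]) simp
  qed
  show "\<exists>g. lead_coeff g = 1 \<and> poly (map_poly (subst f) g) b = 0"
    using integral_over_image[OF subst.comm_ring_hom_axioms G(1) gen, of b] by blast
qed

section \<open>Prime ideals in the image of a ring homomorphism\<close>

lemma ring_hom_range_closed:
  assumes "comm_ring_hom h"
  shows "0 \<in> range h" "1 \<in> range h" "x \<in> range h \<Longrightarrow> y \<in> range h \<Longrightarrow> x + y \<in> range h"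
    "x \<in> range h \<Longrightarrow> y \<in> range h \<Longrightarrow> x * y \<in> range h" "x \<in> range h \<Longrightarrow> - x \<in> range h"
proof -
  interpret comm_ring_hom h by (rule assms)
  show "0 \<in> range h" "1 \<in> range h"
    using hom_zero hom_one by (metis rangeI)+
  show "x \<in> range h \<Longrightarrow> y \<in> range h \<Longrightarrow> x + y \<in> range h"
    by (auto simp flip: hom_add)
  show "x \<in> range h \<Longrightarrow> y \<in> range h \<Longrightarrow> x * y \<in> range h"
    by (auto simp flip: hom_mult)
  show "x \<in> range h \<Longrightarrow> - x \<in> range h"
    by (auto simp flip: hom_uminus)
qed

lemma cring_subring_of_range:
  fixes h :: "'n cpoly \<Rightarrow> 'n cpoly"
  assumes "comm_ring_hom h"
  shows "cring (subring_of (range h))"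
proof -
  have "subring (range h) cpoly_ring"
    using ring_hom_range_closed[OF assms] by (intro ring.subringI[OF ring_cpoly_ring]) simp_all
  then have "subcring (range h) cpoly_ring" by (rule cring.subcringI'[OF cring_cpoly_ring])
  then show ?thesis by (subst (asm) ring.subcring_iff[OF ring_cpoly_ring]) simp_all
qed

lemma primeideal_subring_ofD:
  fixes I :: "'n cpoly set"
  assumes "primeideal I (subring_of A)"
  shows "I \<subseteq> A" "0 \<in> I" "I \<noteq> A" "x \<in> A \<Longrightarrow> y \<in> I \<Longrightarrow> x * y \<in> I"
    "x \<in> A \<Longrightarrow> y \<in> A \<Longrightarrow> x * y \<in> I \<Longrightarrow> x \<in> I \<or> y \<in> I"
proof -
  interpret primeideal I "subring_of A" by (rule assms)
  show "I \<subseteq> A" using a_subset by simp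
  show "0 \<in> I" using additive_subgroup.zero_closed[OF is_additive_subgroup] by simp
  show "I \<noteq> A" using I_notcarr by auto
  show "x \<in> A \<Longrightarrow> y \<in> I \<Longrightarrow> x * y \<in> I" using I_l_closed[of y x] by simp
  show "x \<in> A \<Longrightarrow> y \<in> A \<Longrightarrow> x * y \<in> I \<Longrightarrow> x \<in> I \<or> y \<in> I" using I_prime[of x y] by simp
qed

text \<open>A general injective \<open>h\<close> covers A (\<open>h = subst f\<close>) and B
  (\<open>h = id\<close>) together; the conditions on \<open>I\<close> live in the source, where
  they are read off from divisibility.\<close>

lemma primeideal_image:
  fixes h :: "'n cpoly \<Rightarrow> 'n cpoly"
  assumes h: "comm_ring_hom h" "inj h"
    and I: "0 \<in> I" "1 \<notin> I" "\<And>x y. x \<in> I \<Longrightarrow> y \<in> I \<Longrightarrow> x + y \<in> I" "\<And>x y. y \<in> I \<Longrightarrow> x * y \<in> I"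
    and prime: "\<And>x y. x * y \<in> I \<Longrightarrow> x \<in> I \<or> y \<in> I"
  shows "primeideal (h ` I) (subring_of (range h))"
proof -
  interpret h: comm_ring_hom h by (rule h(1))
  let ?S = "subring_of (range h)"
  note c = ring_hom_range_closed[OF h(1)]
  interpret S: cring ?S by (rule cring_subring_of_range[OF h(1)])
  have inv: "\<ominus>\<^bsub>?S\<^esub> x = - x" if "x \<in> range h" for x
    by (rule S.minus_equality) (use that c(5)[OF that] in simp_all)
  have I_uminus: "- x \<in> I" if "x \<in> I" for x
    using I(4)[OF that, of "- 1"] by simp
  have mem: "h x \<in> h ` I \<longleftrightarrow> x \<in> I" for x using h(2) by (rule inj_image_mem_iff)
  show ?thesis
  proof (rule primeidealI)
    show "ideal (h ` I) ?S"
    proof (rule idealI)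
      show "ring ?S" by (rule S.ring_axioms)
      show "subgroup (h ` I) (add_monoid ?S)"
      proof (rule subgroup.intro)
        show "h ` I \<subseteq> carrier (add_monoid ?S)" by auto
        show "x \<otimes>\<^bsub>add_monoid ?S\<^esub> y \<in> h ` I" if "x \<in> h ` I" "y \<in> h ` I" for x y
          using that I(3) by (auto simp flip: h.hom_add)
        show "\<one>\<^bsub>add_monoid ?S\<^esub> \<in> h ` I" using imageI[OF I(1), of h] by simp
        show "inv\<^bsub>add_monoid ?S\<^esub> x \<in> h ` I" if "x \<in> h ` I" for x
        proof -
          from that obtain y where y: "x = h y" "y \<in> I" by blast
          then have "inv\<^bsub>add_monoid ?S\<^esub> x = h (- y)"
            using inv[of x] by (simp add: a_inv_def h.hom_uminus)
          then show ?thesis using I_uminus[OF y(2)] by simp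
        qed
      qed
      show "x \<otimes>\<^bsub>?S\<^esub> a \<in> h ` I" if "a \<in> h ` I" "x \<in> carrier ?S" for a x
        using that I(4) by (auto simp flip: h.hom_mult)
      then show "a \<otimes>\<^bsub>?S\<^esub> x \<in> h ` I" if "a \<in> h ` I" "x \<in> carrier ?S" for a x
        using that by (simp add: mult.commute)
    qed
    show "cring ?S" by (rule S.cring_axioms)
    show "carrier ?S \<noteq> h ` I"
    proof
      assume "carrier ?S = h ` I"
      then have "range h = h ` I" by simp
      then have "h 1 \<in> h ` I" by (metis rangeI)
      with mem I(2) show False by blast
    qed
    fix a b assume "a \<in> carrier ?S" "b \<in> carrier ?S" "a \<otimes>\<^bsub>?S\<^esub> b \<in> h ` I"
    then obtain x y where "a = h x" "b = h y" "h (x * y) \<in> h ` I" by (auto simp: h.hom_mult)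
    then show "a \<in> h ` I \<or> b \<in> h ` I" using mem prime by blast
  qed
qed

lemma primeideal_image_multiples:
  fixes h :: "'n::linorder cpoly \<Rightarrow> 'n cpoly"
  assumes "comm_ring_hom h" "inj h" "prime_elem p"
  shows "primeideal (h ` multiples p) (subring_of (range h))"
proof (rule primeideal_image[OF assms(1,2)])
  show "1 \<notin> multiples p" using prime_elem_not_unit[OF assms(3)] by simp
  show "x \<in> multiples p \<or> y \<in> multiples p" if "x * y \<in> multiples p" for x y
    using prime_elem_dvd_multD[OF assms(3)] that by simp
qed simp_all

lemma primeideal_image_zero:
  fixes h :: "'n::linorder cpoly \<Rightarrow> 'n cpoly"
  assumes "comm_ring_hom h" "inj h"
  shows "primeideal (h ` {0}) (subring_of (range h))"
  by (rule primeideal_image[OF assms]) auto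

section \<open>Height one primes and principal primes\<close>

lemma height_eq_1I:
  assumes "primeideal P R" "primeideal Z R" "Z \<subset> P"
    and max: "\<And>C0 C1. primeideal C0 R \<Longrightarrow> primeideal C1 R \<Longrightarrow> C0 \<subset> C1 \<Longrightarrow> C1 \<subset> P \<Longrightarrow> False"
  shows "height R P = 1"
  unfolding height_def
proof (rule antisym)
  show "Sup {enat n |n. \<exists>C. (\<forall>i\<le>n. primeideal (C i) R) \<and> (\<forall>i<n. C i \<subset> C (Suc i)) \<and> C n = P} \<le> 1"
  proof (rule Sup_least, clarify)
    fix n and C :: "nat \<Rightarrow> _ set"
    assume C: "\<forall>i\<le>n. primeideal (C i) R" "\<forall>i<n. C i \<subset> C (Suc i)" "P = C n"
    show "enat n \<le> 1"
    proof (rule ccontr)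
      assume "\<not> enat n \<le> 1"
      then have "n \<ge> 2" by (simp add: one_enat_def)
      \<comment> \<open>A chain of length \<open>n\<close> has \<open>n + 1\<close> members; from
        length 2 on, the top three already contradict \<open>max\<close>.\<close>
      then obtain m where m: "n = Suc (Suc m)" by (metis add_2_eq_Suc le_Suc_ex)
      show False
        by (rule max[of "C m" "C (Suc m)"]) (use C m in auto)
    qed
  qed
  show "1 \<le> Sup {enat n |n. \<exists>C. (\<forall>i\<le>n. primeideal (C i) R) \<and> (\<forall>i<n. C i \<subset> C (Suc i)) \<and> C n = P}"
    by (rule Sup_upper, rule CollectI, rule exI[of _ 1], rule conjI, simp add: one_enat_def,
        rule exI[of _ "\<lambda>i. if i = 0 then Z else P"]) (use assms(1-3) in auto)
qed

lemma height_eq_1D: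
  assumes "height R P = 1"
  shows "\<exists>Z. primeideal Z R \<and> Z \<subset> P"
    and "primeideal C0 R \<Longrightarrow> primeideal C1 R \<Longrightarrow> C0 \<subset> C1 \<Longrightarrow> C1 \<subset> P \<Longrightarrow> primeideal P R \<Longrightarrow> False"
proof -
  let ?S = "{enat n |n. \<exists>C. (\<forall>i\<le>n. primeideal (C i) R) \<and> (\<forall>i<n. C i \<subset> C (Suc i)) \<and> C n = P}"
  have S: "Sup ?S = 1" using assms unfolding height_def .
  show "\<exists>Z. primeideal Z R \<and> Z \<subset> P"
  proof (rule ccontr)
    assume no: "\<nexists>Z. primeideal Z R \<and> Z \<subset> P"
    have "Sup ?S \<le> 0"
    proof (rule Sup_least, clarify)
      fix n and C :: "nat \<Rightarrow> _ set"
      assume C: "\<forall>i\<le>n. primeideal (C i) R" "\<forall>i<n. C i \<subset> C (Suc i)" "P = C n"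
      have "n = 0"
      proof (rule ccontr)
        assume "n \<noteq> 0"
        then obtain m where "n = Suc m" using not0_implies_Suc by blast
        with C have "primeideal (C m) R" "C m \<subset> P" by simp_all
        with no show False by blast
      qed
      then show "enat n \<le> 0" by (simp add: zero_enat_def)
    qed
    with S show False by simp
  qed
  assume C: "primeideal C0 R" "primeideal C1 R" "C0 \<subset> C1" "C1 \<subset> P" "primeideal P R"
  have "enat 2 \<le> Sup ?S"
    by (rule Sup_upper, rule CollectI, rule exI[of _ 2], rule conjI, rule refl,
        rule exI[of _ "\<lambda>i. if i = 0 then C0 else if i = 1 then C1 else P"])
      (use C in \<open>auto simp: less_Suc_eq numeral_2_eq_2\<close>)
  with S show False by (simp add: one_enat_def)
qed

text \<open>A prime strictly between would contain a nonzero \<open>p ^ k * b\<close> with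
  \<open>p\<close> not dividing \<open>b\<close>. Being inside \<open>(p)\<close> it misses
  \<open>b\<close>, so it contains a power of \<open>p\<close>, hence \<open>p\<close>, and then it
  is all of \<open>(p)\<close>.\<close>

lemma image_multiples_in_Spec1:
  fixes h :: "'n::{finite,linorder} cpoly \<Rightarrow> 'n cpoly"
  assumes h: "comm_ring_hom h" "inj h" and p: "prime_elem p"
  shows "h ` multiples p \<in> Spec1 (subring_of (range h))"
  unfolding Spec1_def
proof (intro CollectI conjI)
  interpret h: comm_ring_hom h by (rule h(1))
  show prime: "primeideal (h ` multiples p) (subring_of (range h))"
    by (rule primeideal_image_multiples[OF h p])
  have p': "p \<noteq> 0" "\<not> p dvd 1" using p by (auto simp: prime_elem_def)
  show "height (subring_of (range h)) (h ` multiples p) = 1"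
  proof (rule height_eq_1I[OF prime primeideal_image_zero[OF h]])
    have "h p \<in> h ` multiples p" "h p \<notin> h ` {0}" 
      using inj_image_mem_iff[OF h(2), of p] p'(1) by (simp_all only: mem_multiples dvd_refl singleton_iff) simp
    moreover have "h ` {0} \<subseteq> h ` multiples p" by (rule image_mono) simp
    ultimately show "h ` {0} \<subset> h ` multiples p" by blast
  next
    fix C0 C1
    assume C: "primeideal C0 (subring_of (range h))" "primeideal C1 (subring_of (range h))"
      "C0 \<subset> C1" "C1 \<subset> h ` multiples p"
    note C1 = primeideal_subring_ofD[OF C(2)]
    obtain x where x: "x \<in> C1" "x \<notin> C0" using C(3) by blast
    then obtain a where a: "x = h a" using C1(1) by blast
    have "a \<noteq> 0" using x a primeideal_subring_ofD(2)[OF C(1)] by auto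
    then obtain k b where kb: "a = p ^ k * b" "\<not> p dvd b" using ex_power_decomposition[OF _ p'(2)] by blast
    have "h b \<notin> h ` multiples p" 
      using inj_image_mem_iff[OF h(2), of b] kb(2) by (simp only: mem_multiples) simp
    then have "h b \<notin> C1" using C(4) by blast
    then have hk: "h (p ^ k) \<in> C1" using C1(5)[of "h (p ^ k)" "h b"] x a kb by (auto simp: h.hom_mult)
    have hp: "h p \<notin> C1"
    proof
      assume "h p \<in> C1"
      then have "h ` multiples p \<subseteq> C1"
        using C1(4)[of _ "h p"] by (auto simp: h.hom_mult dvd_def mult.commute)
      with C(4) show False by blast
    qed
    have "h 1 \<notin> C1"
    proof
      assume *: "h 1 \<in> C1"
      have "range h \<subseteq> C1"
      proof clarify
        fix y
        show "h y \<in> C1" using C1(4)[of "h y" "h 1"] * by simp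
      qed
      with C1(1,3) show False by blast
    qed
    moreover have "h (p ^ j) \<in> C1 \<Longrightarrow> h 1 \<in> C1" for j
    proof (induction j)
      case (Suc j)
      then have "h p * h (p ^ j) \<in> C1" by (simp add: h.hom_mult)
      then show ?case using C1(5)[of "h p" "h (p ^ j)"] hp Suc.IH by blast
    qed simp
    ultimately show False using hk by blast
  qed
qed

text \<open>Height one provides a smaller prime and so a nonzero element of \<open>q\<close>; one of
  its prime factors \<open>p\<close> lies in \<open>q\<close>. The chain from 0 over
  \<open>(p)\<close> to \<open>q\<close> has length at most 1, which forces equality.\<close>

lemma Spec1_cpoly_ring: "q \<in> Spec1 cpoly_ring \<longleftrightarrow> (\<exists>p. prime_elem p \<and> q = multiples p)"
  for q :: "'n::{finite,linorder} cpoly set"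
proof
  have id: "comm_ring_hom (id :: 'n cpoly \<Rightarrow> 'n cpoly)" by unfold_locales simp_all
  {
    assume "\<exists>p. prime_elem p \<and> q = multiples p"
    then show "q \<in> Spec1 cpoly_ring"
      using image_multiples_in_Spec1[OF id inj_on_id] subring_of_UNIV by (metis image_id id_apply)
  }
  assume "q \<in> Spec1 cpoly_ring"
  then have q: "primeideal q (subring_of UNIV)" "height (subring_of UNIV) q = 1"
    by (simp_all add: Spec1_def subring_of_UNIV)
  note qD = primeideal_subring_ofD[OF q(1)]
  obtain Z where Z: "primeideal Z (subring_of UNIV)" "Z \<subset> q" using height_eq_1D(1)[OF q(2)] by blast
  then obtain a where a: "a \<in> q" "a \<noteq> 0" using primeideal_subring_ofD(2)[OF Z(1)] by blast
  have "1 \<notin> q"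
  proof
    assume "1 \<in> q"
    then have "UNIV \<subseteq> q" using qD(4)[of _ 1] by auto
    with qD(3) show False by blast
  qed
  have "\<exists>p. prime_elem p \<and> p \<in> q" using a
  proof (induction "sum_deg a" arbitrary: a rule: less_induct)
    case less
    have "\<not> a dvd 1"
    proof
      assume "a dvd 1"
      then obtain b where "1 = a * b" ..
      then have "1 \<in> q" using qD(4)[of b a] less.prems(1) by (simp add: mult.commute)
      with \<open>1 \<notin> q\<close> show False ..
    qed
    with less.prems obtain r s where rs: "prime_elem r" "a = r * s" "sum_deg s < sum_deg a"
      using ex_prime_factor by blast
    then have "r \<in> q \<or> s \<in> q" using qD(5)[of r s] less.prems by simp
    then show ?case using less.hyps[OF rs(3)] rs less.prems(2) by auto
  qed
  then obtain p where p: "prime_elem p" "p \<in> q" by blast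
  have sub: "multiples p \<subseteq> q" using qD(4)[of _ p] p(2) by (auto simp: dvd_def mult.commute)
  have "\<not> multiples p \<subset> q"
  proof
    assume *: "multiples p \<subset> q"
    have 1: "primeideal {0} (subring_of (UNIV :: 'n cpoly set))"
      using primeideal_image_zero[OF id inj_on_id] by simp
    have 2: "primeideal (multiples p) (subring_of UNIV)"
      using primeideal_image_multiples[OF id inj_on_id p(1)] by simp
    have "p \<noteq> 0" "p \<in> multiples p" "0 \<in> multiples p" using p(1) by auto
    then have 3: "{0} \<subset> multiples p" by blast
    from height_eq_1D(2)[OF q(2) 1 2 3 * q(1)] show False .
  qed
  with sub p(1) show "\<exists>p. prime_elem p \<and> q = multiples p" by blast
qed

section \<open>Ramification\<close>

lemma generates_cpoly_ring: "generates cpoly_ring Q q \<longleftrightarrow> q = multiples Q"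
  by (auto simp: generates_def cgenideal_def multiples_def dvd_def mult.commute)

lemma cgenideal_cpoly_ring: "PIdl\<^bsub>cpoly_ring\<^esub> a = multiples a"
  using generates_cpoly_ring[of a "PIdl\<^bsub>cpoly_ring\<^esub> a"] by (simp add: generates_def)

lemma generates_subring_of: "generates (subring_of A) P I \<longleftrightarrow> P \<in> A \<and> I = {x * P |x. x \<in> A}"
  by (simp add: generates_def cgenideal_def)

lemma mult_of_eqI:
  assumes "Q ^ n dvd P" "\<not> Q ^ Suc n dvd P"
  shows "mult_of Q P = n"
proof -
  have "{k. Q ^ k dvd P} = {..n}"
  proof (intro Set.set_eqI iffI)
    fix k assume "k \<in> {k. Q ^ k dvd P}"
    then have "Q ^ k dvd P" by simp
    then have "\<not> Suc n \<le> k" using assms(2) power_le_dvd by blast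
    then show "k \<in> {..n}" by simp
  next
    fix k assume "k \<in> {..n}"
    then show "k \<in> {k. Q ^ k dvd P}" using assms(1) power_le_dvd by auto
  qed
  then show ?thesis unfolding mult_of_def by (auto intro!: Max_eqI)
qed

lemma power_dvd_iff_if_multiples_eq:
  assumes "multiples p = multiples q"
  shows "p ^ k dvd a \<longleftrightarrow> q ^ k dvd a"
proof -
  have "p dvd q" "q dvd p" using assms multiples_eq_iff by blast+
  then have "p ^ k dvd q ^ k" "q ^ k dvd p ^ k" by (simp_all add: dvd_power_same)
  then show ?thesis by (meson dvd_trans)
qed

section \<open>Contraction, ramification indices and the two formulas\<close>

context finite_subst
begin

abbreviation A where "A \<equiv> range (subst f)"

lemma comm_ring_hom_subst: "comm_ring_hom (subst f)"
  by (rule subst.comm_ring_hom_axioms)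

lemma inter_range_subst: "q \<inter> A = subst f ` (subst f -` q)"
  by auto

text \<open>By injectivity, contractions to A can be handled as preimages under
  \<open>subst f\<close>, ideals of a ring with unique factorisation.\<close>

lemma contraction_eq_iff: "q \<inter> A = subst f ` I \<longleftrightarrow> subst f -` q = I"
  unfolding inter_range_subst by (rule inj_image_eq_iff[OF inj_subst])

lemma contraction_cong: "q \<inter> A = q' \<inter> A \<longleftrightarrow> subst f -` q = subst f -` q'"
  unfolding inter_range_subst by (rule inj_image_eq_iff[OF inj_subst])

lemma ex_contraction:
  assumes "prime_elem q"
  obtains p where "prime_elem p" "subst f -` multiples q = multiples p"
proof -
  interpret prime_over f q by unfold_locales (rule assms)
  show thesis
  proof (rule ex_prime_below)
    fix p
    assume p: "prime_elem p" "\<And>g. q dvd subst f g \<longleftrightarrow> p dvd g"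
    have "subst f -` multiples q = multiples p" by (intro Set.set_eqI) (simp add: p(2))
    with p(1) show thesis by (rule that)
  qed
qed

lemma contraction_in_Spec1:
  assumes "q \<in> Spec1 cpoly_ring"
  shows "q \<inter> A \<in> Spec1 (subring_of A)"
proof -
  from assms obtain Q where Q: "prime_elem Q" "q = multiples Q" unfolding Spec1_cpoly_ring by blast
  obtain p where p: "prime_elem p" "subst f -` multiples Q = multiples p" using ex_contraction[OF Q(1)] .
  then have "q \<inter> A = subst f ` multiples p" unfolding contraction_eq_iff Q(2) by simp
  then show ?thesis
    using image_multiples_in_Spec1[OF comm_ring_hom_subst inj_subst p(1)] by simp
qed

text \<open>Resolves the two choices hidden in \<open>ram_index\<close>: other generators are
  associates of \<open>Q\<close>, respectively images of associates of \<open>p\<close>, and have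
  the same multiplicities.\<close>

lemma ram_index_multiplicity:
  assumes Q: "prime_elem Q" and p: "prime_elem p" "subst f -` multiples Q = multiples p"
  obtains n where "ram_index A (multiples Q) = Suc n"
    "Q ^ Suc n dvd subst f p" "\<not> Q ^ Suc (Suc n) dvd subst f p" "Q ^ n dvd J" "\<not> Q ^ Suc n dvd J"
proof -
  interpret prime_over f Q by unfold_locales (rule Q)
  have below: "Q dvd subst f g \<longleftrightarrow> p dvd g" for g
    using arg_cong[OF p(2), of "\<lambda>S. g \<in> S"] by simp
  have "subst f p \<noteq> 0" using subst_eq_0_iff p(1) by auto
  then obtain k r where kr: "subst f p = Q ^ k * r" "\<not> Q dvd r"
    using ex_power_decomposition[OF _ not_dvd_1] by blast
  have "Q dvd subst f p" using below by simp
  then have "k \<noteq> 0" using kr by (cases k) auto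
  then obtain n where n: "k = Suc n" using not0_implies_Suc by blast
  have dvd: "Q ^ Suc n dvd subst f p" unfolding kr n by simp
  have ndvd: "\<not> Q ^ Suc (Suc n) dvd subst f p"
  proof
    assume "Q ^ Suc (Suc n) dvd subst f p"
    then have "Q ^ k * Q dvd Q ^ k * r" unfolding kr n by (simp add: mult.commute)
    moreover have "Q ^ k \<noteq> 0" using Q by auto
    ultimately show False using kr(2) by (subst (asm) dvd_mult_cancel_left) simp
  qed
  define Q' where "Q' = (SOME Q'. generates cpoly_ring Q' (multiples Q))"
  have "generates cpoly_ring Q' (multiples Q)"
    unfolding Q'_def by (rule someI[of _ Q]) (simp add: generates_cpoly_ring)
  then have Q': "multiples Q' = multiples Q" by (simp add: generates_cpoly_ring)
  \<comment> \<open>Principal ideals of A are images of principal ideals of the source, and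
    injectivity allows comparing them there.\<close>
  have gen_iff: "generates (subring_of A) P (multiples Q \<inter> A) \<longleftrightarrow> (\<exists>p'. P = subst f p' \<and> multiples p' = multiples p)" for P
  proof -
    have *: "{x * subst f p' |x. x \<in> A} = subst f ` multiples p'" for p'
    proof (intro Set.set_eqI iffI)
      fix y assume "y \<in> {x * subst f p' |x. x \<in> A}"
      then obtain a where "y = subst f a * subst f p'" by blast
      then have "y = subst f (p' * a)" by (simp add: subst_mult mult.commute)
      moreover have "p' * a \<in> multiples p'" by simp
      ultimately show "y \<in> subst f ` multiples p'" by blast
    next
      fix y assume "y \<in> subst f ` multiples p'"
      then obtain a where "y = subst f (p' * a)" unfolding multiples_def dvd_def by blast
      then have "y = subst f a * subst f p'" by (simp add: subst_mult mult.commute)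
      then show "y \<in> {x * subst f p' |x. x \<in> A}" by blast
    qed
    show ?thesis
    proof
      assume P: "generates (subring_of A) P (multiples Q \<inter> A)"
      then obtain p' where p': "P = subst f p'" unfolding generates_subring_of by blast
      from P have "multiples Q \<inter> A = {x * P |x. x \<in> A}" unfolding generates_subring_of by (rule conjunct2)
      also have "\<dots> = subst f ` multiples p'" unfolding p' by (rule *)
      finally have "multiples p' = multiples p" unfolding contraction_eq_iff p(2) by (rule sym)
      with p' show "\<exists>p'. P = subst f p' \<and> multiples p' = multiples p" by blast
    next
      assume "\<exists>p'. P = subst f p' \<and> multiples p' = multiples p"
      then obtain p' where p': "P = subst f p'" "multiples p' = multiples p" by blast
      from p'(2)[symmetric] have "multiples Q \<inter> A = subst f ` multiples p'"
        unfolding contraction_eq_iff p(2) .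
      from this[folded *] show "generates (subring_of A) P (multiples Q \<inter> A)"
        unfolding generates_subring_of p'(1) by (intro conjI rangeI)
    qed
  qed
  define P where "P = (SOME P. generates (subring_of A) P (multiples Q \<inter> A))"
  have "generates (subring_of A) P (multiples Q \<inter> A)"
    unfolding P_def by (rule someI[of _ "subst f p"]) (use gen_iff in blast)
  then obtain p' where p': "P = subst f p'" "multiples p' = multiples p" using gen_iff by blast
  have P_dvd: "Q' ^ j dvd P \<longleftrightarrow> Q ^ j dvd subst f p" for j
  proof -
    have "p' dvd p" "p dvd p'" using p'(2) multiples_eq_iff by blast+
    then have "P dvd subst f p" "subst f p dvd P" unfolding p'(1) dvd_def using subst_mult by metis+
    then have "Q ^ j dvd P \<longleftrightarrow> Q ^ j dvd subst f p" using dvd_trans by blast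
    then show ?thesis using power_dvd_iff_if_multiples_eq[OF Q'] by simp
  qed
  have "ram_index A (multiples Q) = mult_of Q' P" by (simp add: ram_index_def Q'_def P_def)
  also have "\<dots> = Suc n" by (rule mult_of_eqI) (use P_dvd dvd ndvd in blast)+
  finally have "ram_index A (multiples Q) = Suc n" .
  moreover have "Q ^ n dvd J \<and> \<not> Q ^ Suc n dvd J"
    by (rule jacobian_multiplicity[OF p(1) below kr[unfolded n]])
  ultimately show thesis using that dvd ndvd by blast
qed

text \<open>\<open>Q\<close> divides \<open>J\<close> exactly \<open>e - 1\<close> times, so being
  ramified means dividing \<open>J\<close>; since \<open>J\<close> is nonzero, the ramified primes
  are finite in number.\<close>

lemma Spec1_ram_eq: "Spec1_ram A = prime_divisors J"
proof (intro Set.set_eqI iffI)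
  fix q assume "q \<in> Spec1_ram A"
  then have q: "q \<in> Spec1 cpoly_ring" "ram_index A q > 1" by (simp_all add: Spec1_ram_def ramified_def)
  then obtain Q where Q: "prime_elem Q" "q = multiples Q" unfolding Spec1_cpoly_ring by blast
  obtain p where p: "prime_elem p" "subst f -` multiples Q = multiples p" using ex_contraction[OF Q(1)] .
  obtain n where n: "ram_index A (multiples Q) = Suc n" "Q ^ n dvd J"
    using ram_index_multiplicity[OF Q(1) p] by blast
  with q(2) Q(2) have "n \<noteq> 0" by auto
  then have "Q dvd J" using n(2) by (metis dvd_power dvd_trans gr0I)
  with Q show "q \<in> prime_divisors J" by (auto simp: prime_divisors_def)
next
  fix q assume "q \<in> prime_divisors J"
  then obtain Q where Q: "q = multiples Q" "prime_elem Q" "Q dvd J" by (auto simp: prime_divisors_def)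
  obtain p where p: "prime_elem p" "subst f -` multiples Q = multiples p" using ex_contraction[OF Q(2)] .
  obtain n where n: "ram_index A (multiples Q) = Suc n" "\<not> Q ^ Suc n dvd J"
    using ram_index_multiplicity[OF Q(2) p] by blast
  with Q(3) have "n \<noteq> 0" by (cases n) auto
  with n(1) have "ramified A q" by (simp add: ramified_def Q(1))
  moreover have "q \<in> Spec1 cpoly_ring" unfolding Spec1_cpoly_ring using Q by blast
  ultimately show "q \<in> Spec1_ram A" by (simp add: Spec1_ram_def)
qed

lemma finite_Spec1_ram: "finite (Spec1_ram A)"
  unfolding Spec1_ram_eq by (rule finite_prime_divisors[OF jacobian_neq_0])

context
  fixes Q :: "'n cpoly set \<Rightarrow> 'n cpoly"
  assumes Q: "\<And>q. q \<in> Spec1_ram A \<Longrightarrow> multiples (Q q) = q"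
begin

lemma prime_generator: "q \<in> Spec1_ram A \<Longrightarrow> prime_elem (Q q)"
  using Q[of q] prime_elem_if_multiples_eq unfolding Spec1_ram_eq prime_divisors_def by auto

lemma jacobian_factorisation:
  "\<exists>c. c \<noteq> 0 \<and> J = const_poly c * (\<Prod>q\<in>Spec1_ram A. Q q ^ (ram_index A q - 1))"
  unfolding Spec1_ram_eq
proof (rule prime_power_factorisation[OF jacobian_neq_0])
  fix q assume "q \<in> prime_divisors J"
  then have q: "q \<in> Spec1_ram A" by (simp add: Spec1_ram_eq)
  then show "multiples (Q q) = q" by (rule Q)
  obtain p where p: "prime_elem p" "subst f -` multiples (Q q) = multiples p"
    using ex_contraction[OF prime_generator[OF q]] .
  obtain n where "ram_index A (multiples (Q q)) = Suc n" "Q q ^ n dvd J" "\<not> Q q ^ Suc n dvd J"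
    using ram_index_multiplicity[OF prime_generator[OF q] p] by blast
  then show "Q q ^ (ram_index A q - 1) dvd J \<and> \<not> Q q ^ Suc (ram_index A q - 1) dvd J"
    unfolding Q[OF q] by simp
qed

text \<open>
  If the extension is well-ramified, then \<open>\<Prod> Q\<^bsup>e\<^esup>\<close> is, up to a scalar, the product of the
  generators of the contractions of the ramified primes.
\<close>

lemma contraction_of_jacobian_ideal:
  assumes wr: "well_ramified A"
  shows "generates (subring_of A) (\<Prod>q\<in>Spec1_ram A. Q q ^ ram_index A q) (multiples J \<inter> A)"
proof -
  let ?R = "Spec1_ram A" and ?P = "\<Prod>q\<in>Spec1_ram A. Q q ^ ram_index A q"
  \<comment> \<open>Several ramified primes may have the same contraction; the image set counts each
    contraction once.\<close>
  define N where "N = (\<lambda>q. subst f -` q) ` ?R"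
  have fin: "finite N" unfolding N_def using finite_Spec1_ram by simp
  have "\<exists>p. prime_elem p \<and> multiples p = I" if "I \<in> N" for I
  proof -
    from that obtain q where q: "q \<in> ?R" "I = subst f -` q" by (auto simp: N_def)
    show ?thesis using ex_contraction[OF prime_generator[OF q(1)]] unfolding Q[OF q(1)] q(2) by metis
  qed
  then obtain g where g: "\<And>I. I \<in> N \<Longrightarrow> prime_elem (g I)" "\<And>I. I \<in> N \<Longrightarrow> multiples (g I) = I" by metis
  define h where "h = (\<Prod>I\<in>N. g I)"
  have "h \<noteq> 0" unfolding h_def using fin g(1) by (auto simp: prime_elem_def)
  then have h0: "subst f h \<noteq> 0" by (simp add: subst_eq_0_iff)
  have subst_h: "subst f h = (\<Prod>I\<in>N. subst f (g I))"
    unfolding h_def by (rule subst.hom_prod)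
  have contraction: "subst f -` multiples r = I" if r: "prime_elem r" and I: "I \<in> N" and dvd: "r dvd subst f (g I)" for r I
  proof -
    obtain p where p: "prime_elem p" "subst f -` multiples r = multiples p" using ex_contraction[OF r] .
    then have "p dvd g I" using dvd by (metis mem_multiples vimage_eq)
    then have "multiples p = multiples (g I)" by (rule multiples_eq_if_prime_dvd[OF p(1) g(1)[OF I]])
    then show ?thesis using p(2) g(2)[OF I] by simp
  qed
  have below: "Q q dvd subst f (g (subst f -` q))" and inN: "subst f -` q \<in> N" if "q \<in> ?R" for q
  proof -
    show "subst f -` q \<in> N" using that by (simp add: N_def)
    then have "g (subst f -` q) \<in> subst f -` q" using g(2) mem_multiples dvd_refl by blast
    then have "subst f (g (subst f -` q)) \<in> multiples (Q q)" using Q[OF that] by simp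
    then show "Q q dvd subst f (g (subst f -` q))" by simp
  qed
  have divs: "prime_divisors (subst f h) = ?R"
  proof (intro Set.set_eqI iffI)
    fix q assume "q \<in> prime_divisors (subst f h)"
    then obtain r where r: "q = multiples r" "prime_elem r" "r dvd subst f h" by (auto simp: prime_divisors_def)
    then obtain I where I: "I \<in> N" "r dvd subst f (g I)"
      using prime_elem_not_dvd_prod[OF r(2) fin, of "\<lambda>I. subst f (g I)"] unfolding subst_h by blast
    then obtain q' where q': "q' \<in> ?R" "I = subst f -` q'" by (auto simp: N_def)
    have "q \<inter> A = q' \<inter> A"
      unfolding contraction_cong using contraction[OF r(2) I] r(1) q'(2) by simp
    moreover have q: "q \<in> Spec1 cpoly_ring" unfolding Spec1_cpoly_ring using r by blast
    moreover have "q' \<in> Spec1 cpoly_ring" "ramified A q'" using q'(1) by (simp_all add: Spec1_ram_def)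
    \<comment> \<open>The only use of well-ramifiedness: a prime factor of \<open>subst f h\<close>
      lies over the same prime of A as some ramified \<open>q'\<close>, hence is ramified
      itself.\<close>
    ultimately have "ramified A q"
      using wr contraction_in_Spec1[OF q] unfolding well_ramified_def by metis
    with q show "q \<in> ?R" by (simp add: Spec1_ram_def)
  next
    fix q assume q: "q \<in> ?R"
    have "Q q dvd subst f h"
      unfolding subst_h using below[OF q] dvd_prodI[OF fin inN[OF q], of "\<lambda>I. subst f (g I)"] dvd_trans by blast
    then show "q \<in> prime_divisors (subst f h)"
      using prime_generator[OF q] Q[OF q] unfolding prime_divisors_def by blast
  qed
  have "\<exists>c. c \<noteq> 0 \<and> subst f h = const_poly c * (\<Prod>q\<in>prime_divisors (subst f h). Q q ^ ram_index A q)"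
  proof (rule prime_power_factorisation[OF h0])
    fix q assume "q \<in> prime_divisors (subst f h)"
    then have q: "q \<in> ?R" unfolding divs .
    then show "multiples (Q q) = q" by (rule Q)
    let ?I = "subst f -` q"
    note prime = prime_generator[OF q]
    have "subst f -` multiples (Q q) = multiples (g ?I)" using Q[OF q] g(2)[OF inN[OF q]] by simp
    then obtain n where n: "ram_index A (multiples (Q q)) = Suc n"
      "Q q ^ Suc n dvd subst f (g ?I)" "\<not> Q q ^ Suc (Suc n) dvd subst f (g ?I)"
      using ram_index_multiplicity[OF prime g(1)[OF inN[OF q]]] by blast
    \<comment> \<open>Among the factors of \<open>subst f h\<close>, only the one for the
      contraction of \<open>q\<close> is divisible by \<open>Q q\<close>, because a prime has a
      single contraction. So the multiplicity in the whole product is that in this factor, namely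
      \<open>e\<close>.\<close>
    have split: "subst f h = subst f (g ?I) * (\<Prod>I\<in>N - {?I}. subst f (g I))"
      unfolding subst_h by (rule prod.remove[OF fin inN[OF q]])
    have "\<not> Q q dvd (\<Prod>I\<in>N - {?I}. subst f (g I))"
    proof (rule prime_elem_not_dvd_prod[OF prime])
      fix I assume I: "I \<in> N - {?I}"
      show "\<not> Q q dvd subst f (g I)"
        using contraction[OF prime, of I] I Q[OF q] by auto
    qed (use fin in simp)
    then have "\<not> Q q ^ Suc (Suc n) dvd subst f h"
      using n(3) prime_elem_power_dvd_mult_cancel[OF prime] unfolding split by (metis mult.commute)
    moreover have "Q q ^ Suc n dvd subst f h" unfolding split using n(2) by (rule dvd_mult2)
    ultimately show "Q q ^ ram_index A q dvd subst f h \<and> \<not> Q q ^ Suc (ram_index A q) dvd subst f h"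
      using n(1) unfolding Q[OF q] by simp
  qed
  then obtain c where c: "c \<noteq> 0" "subst f h = const_poly c * ?P" unfolding divs by blast
  have "?P = const_poly (inverse c) * (const_poly c * ?P)"
    using c(1) by (simp add: mult.assoc[symmetric] const_poly_mult[symmetric])
  also have "\<dots> = subst f (const_poly (inverse c) * h)" by (simp add: subst_mult c(2))
  finally have PA: "?P \<in> A" by blast
  have JP: "J dvd ?P"
  proof -
    obtain d where d: "d \<noteq> 0" "J = const_poly d * (\<Prod>q\<in>?R. Q q ^ (ram_index A q - 1))"
      using jacobian_factorisation by blast
    have *: "(\<Prod>q\<in>?R. Q q ^ (ram_index A q - 1)) dvd ?P"
      by (rule prod_dvd_prod) (simp add: le_imp_power_dvd)
    from mult_dvd_mono[OF const_poly_dvd_1[OF d(1)] *] show ?thesis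
      unfolding d(2) by (simp only: mult_1)
  qed
  have "multiples J \<inter> A = {x * ?P |x. x \<in> A}"
  proof (intro subset_antisym subsetI)
    fix x assume "x \<in> {x * ?P |x. x \<in> A}"
    then obtain y where y: "x = y * ?P" "y \<in> A" by blast
    have "x \<in> A" unfolding y(1) by (rule ring_hom_range_closed(4)[OF comm_ring_hom_subst y(2) PA])
    moreover have "J dvd x" unfolding y(1) using JP by (rule dvd_mult)
    ultimately show "x \<in> multiples J \<inter> A" by simp
  next
    fix x assume "x \<in> multiples J \<inter> A"
    then obtain a where a: "x = subst f a" "J dvd subst f a" by auto
    \<comment> \<open>Every ramified \<open>Q q\<close> divides \<open>J\<close> and so
      \<open>subst f a\<close>, which puts \<open>a\<close> into each contraction. The generators
      \<open>g I\<close> are pairwise non-associate primes, whence first powers suffice for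
      \<open>h\<close> to divide \<open>a\<close>.\<close>
    have "(\<Prod>I\<in>N. g I ^ 1) dvd a"
    proof (rule prod_prime_powers_dvd[OF fin g(1)])
      show "inj_on (\<lambda>I. multiples (g I)) N" by (rule inj_onI) (simp add: g(2))
      fix I assume I: "I \<in> N"
      then obtain q where q: "q \<in> ?R" "I = subst f -` q" by (auto simp: N_def)
      then have "q \<in> prime_divisors J" by (simp add: Spec1_ram_eq)
      then have "J \<in> q" by (auto simp: prime_divisors_def)
      then have "Q q dvd J" using Q[OF q(1)] by (metis mem_multiples)
      with a(2) have "Q q dvd subst f a" using dvd_trans by blast
      then have "a \<in> I" unfolding q(2) using Q[OF q(1)] by (metis mem_multiples vimageI)
      then show "g I ^ 1 dvd a" using g(2)[OF I] by (metis mem_multiples power_one_right)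
    qed
    then obtain b where b: "a = h * b" unfolding h_def by auto
    have "x = subst f h * subst f b" unfolding a(1) b by (rule subst_mult)
    also have "\<dots> = subst f (const_poly c * b) * ?P"
      unfolding c(2) subst_mult subst_const by (simp only: ac_simps)
    finally show "x \<in> {x * ?P |x. x \<in> A}" by blast
  qed
  with PA show ?thesis unfolding generates_subring_of by blast
qed

end

end

theorem mainTheorem2:
  fixes w :: "'n::{finite,linorder} \<Rightarrow> nat"
    and f :: "'n \<Rightarrow> 'n cpoly"
    and A :: "'n cpoly set"
    and J :: "'n cpoly"
    and Q :: "'n cpoly set \<Rightarrow> 'n cpoly"
  assumes "finite_graded_polynomial_extension w f"
    and "A = subalgebra_gen f"
    and "J = jacobian f"
    and "\<forall>q \<in> Spec1_ram A. generates cpoly_ring (Q q) q"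
  shows "finite (Spec1_ram A) \<and>
    (\<exists>c. c \<noteq> 0 \<and> J = const_poly c * (\<Prod>q\<in>Spec1_ram A. Q q ^ (ram_index A q - 1))) \<and>
    (well_ramified A \<longrightarrow>
       generates (subring_of A) (\<Prod>q\<in>Spec1_ram A. Q q ^ ram_index A q)
         (PIdl\<^bsub>cpoly_ring\<^esub> J \<inter> A))"
proof -
  have A: "A = range (subst f)" using assms(2) by (simp add: subalgebra_gen_eq_range)
  interpret finite_subst f
    using assms(1,2) A by (intro module_finite_imp_finite_subst) (simp add: finite_graded_polynomial_extension_def)
  have Q: "multiples (Q q) = q" if "q \<in> Spec1_ram (range (subst f))" for q
    using that assms(4) generates_cpoly_ring[of "Q q" q] unfolding A by simp
  show ?thesis
    unfolding A assms(3) cgenideal_cpoly_ring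
    using finite_Spec1_ram jacobian_factorisation[of Q, OF Q] contraction_of_jacobian_ideal[of Q, OF Q]
    by blast
qed

end
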